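(* $[\tau(\mathbf{SemWb})\mathbf{Txt}\mathbf{Sd}\mathbf{Bc}] = [\mathbf{Txt}\mathbf{G}\mathbf{SemConv}\mathbf{Bc}]$.
   Context: Fix an acceptable numbering $(\varphi_e)$ of partial computable functions, $W_e=\mathrm{dom}(\varphi_e)$. A text is a total function $T:\mathbb N\to\mathbb N\cup\{\#\}$, $\mathrm{content}(T)=\mathrm{range}(T)\setminus\{\#\}$, $T[n]=(T(0),\dots,T(n-1))$; $\mathbf{Txt}$ is the set of all texts, $\mathbf{Txt}(L)$ those with content $L$. Learners are partial computable functions; $\mathbf G(h,T)(i)=h(T[i])$ and $\mathbf{Sd}(h,T)(i)=h(\mathrm{content}(T[i]))$. For total $p:\mathbb N\to\mathbb N$ and text $T$: $\mathbf{Bc}(p,T)$ iff $\exists n_0\,\forall n\ge n_0: W_{p(n)}=\mathrm{content}(T)$; $\mathbf{SemWb}(p,T)$ iff for all $n,m$: if there is $k$ with $n\le k\le m$ and $W_{p(n)}\ne W_{p(k)}$, then $(\mathrm{content}(T[m])\cap W_{p(m)})\setminus W_{p(n)}\ne\emptyset$; $\mathbf{SemConv}(p,T)$ iff for all $n<m$ with $\mathrm{content}(T[m])\subseteq W_{p(n)}$ we have $W_{p(n)}=W_{p(m)}$. A learner $h$ $\tau(\alpha)\mathbf{Txt}\beta\delta\mathbf{Bc}$-learns $L$ iff for every $T\in\mathbf{Txt}$, $\beta(h,T)$ is total and $\alpha(\beta(h,T),T)$ holds, and for every $T\in\mathbf{Txt}(L)$, $\delta(\beta(h,T),T)\wedge\mathbf{Bc}(\beta(h,T),T)$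 holds; omitting $\tau(\alpha)$ drops the global requirement (then only totality and the conditions on texts of $L$ are required). $[\cdot]$ is the set of classes learnable by a single learner under the criterion. *)

theory Defs
  imports Main "HOL-Library.Nat_Bijection"
begin

datatype recf = Zero | Succ | Proj nat | Comp recf "recf list" | Prim recf recf | Mn recf

inductive eval_recf :: "recf \<Rightarrow> nat list \<Rightarrow> nat \<Rightarrow> bool" where
  zero: "eval_recf Zero xs 0"
| succ: "eval_recf Succ (x # xs) (Suc x)"
| proj: "i < length xs \<Longrightarrow> eval_recf (Proj i) xs (xs ! i)"
| comp: "list_all2 (\<lambda>g y. eval_recf g xs y) gs ys \<Longrightarrow> eval_recf f ys z
           \<Longrightarrow> eval_recf (Comp f gs) xs z"
| prim0: "eval_recf f xs y \<Longrightarrow> eval_recf (Prim f g) (0 # xs) y"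
| primS: "eval_recf (Prim f g) (n # xs) y \<Longrightarrow> eval_recf g (n # y # xs) z
           \<Longrightarrow> eval_recf (Prim f g) (Suc n # xs) z"
| mn: "eval_recf f (n # xs) 0 \<Longrightarrow> (\<forall>m<n. \<exists>y. eval_recf f (m # xs) (Suc y))
           \<Longrightarrow> eval_recf (Mn f) xs n"

definition partial_computable :: "(nat \<Rightarrow> nat option) \<Rightarrow> bool" where
  "partial_computable f \<longleftrightarrow> (\<exists>r. \<forall>x y. f x = Some y \<longleftrightarrow> eval_recf r [x] y)"

definition total_computable :: "(nat \<Rightarrow> nat) \<Rightarrow> bool" where
  "total_computable t \<longleftrightarrow> partial_computable (\<lambda>x. Some (t x))"

definition uncurried :: "(nat \<Rightarrow> nat \<Rightarrow> nat option) \<Rightarrow> nat \<Rightarrow> nat option" where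
  "uncurried \<psi> n = \<psi> (fst (prod_decode n)) (snd (prod_decode n))"

definition acceptable :: "(nat \<Rightarrow> nat \<Rightarrow> nat option) \<Rightarrow> bool" where
  "acceptable \<phi> \<longleftrightarrow> (\<forall>e. partial_computable (\<phi> e))
     \<and> partial_computable (uncurried \<phi>)
     \<and> (\<forall>\<psi>. partial_computable (uncurried \<psi>) \<longrightarrow>
           (\<exists>t. total_computable t \<and> (\<forall>e. \<phi> (t e) = \<psi> e)))"

definition W :: "(nat \<Rightarrow> nat \<Rightarrow> nat option) \<Rightarrow> nat \<Rightarrow> nat set" where
  "W \<phi> e = {x. \<phi> e x \<noteq> None}"

text \<open>A text is a total function from nat to nat option; None plays the role of the pause symbol.\<close>
type_synonym ltext = "nat \<Rightarrow> nat option"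

definition content :: "ltext \<Rightarrow> nat set" where
  "content T = {x. \<exists>i. T i = Some x}"

definition seg :: "ltext \<Rightarrow> nat \<Rightarrow> nat option list" where
  "seg T n = map T [0..<n]"

definition content_seg :: "ltext \<Rightarrow> nat \<Rightarrow> nat set" where
  "content_seg T n = {x. \<exists>i<n. T i = Some x}"

definition code_seq :: "nat option list \<Rightarrow> nat" where
  "code_seq xs = list_encode (map (case_option 0 Suc) xs)"

definition code_set :: "nat set \<Rightarrow> nat" where
  "code_set A = set_encode A"

definition G :: "(nat \<Rightarrow> nat option) \<Rightarrow> ltext \<Rightarrow> nat \<Rightarrow> nat option" where
  "G h T i = h (code_seq (seg T i))"

definition Sd :: "(nat \<Rightarrow> nat option) \<Rightarrow> ltext \<Rightarrow> nat \<Rightarrow> nat option" where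
  "Sd h T i = h (code_set (content_seg T i))"

definition Bc :: "(nat \<Rightarrow> nat \<Rightarrow> nat option) \<Rightarrow> (nat \<Rightarrow> nat) \<Rightarrow> ltext \<Rightarrow> bool" where
  "Bc \<phi> p T \<longleftrightarrow> (\<exists>n0. \<forall>n\<ge>n0. W \<phi> (p n) = content T)"

definition SemWb :: "(nat \<Rightarrow> nat \<Rightarrow> nat option) \<Rightarrow> (nat \<Rightarrow> nat) \<Rightarrow> ltext \<Rightarrow> bool" where
  "SemWb \<phi> p T \<longleftrightarrow> (\<forall>n m. (\<exists>k. n \<le> k \<and> k \<le> m \<and> W \<phi> (p n) \<noteq> W \<phi> (p k)) \<longrightarrow>
      (content_seg T m \<inter> W \<phi> (p m)) - W \<phi> (p n) \<noteq> {})"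

definition SemConv :: "(nat \<Rightarrow> nat \<Rightarrow> nat option) \<Rightarrow> (nat \<Rightarrow> nat) \<Rightarrow> ltext \<Rightarrow> bool" where
  "SemConv \<phi> p T \<longleftrightarrow> (\<forall>n m. n < m \<and> content_seg T m \<subseteq> W \<phi> (p n) \<longrightarrow>
      W \<phi> (p n) = W \<phi> (p m))"

definition total_seq :: "(nat \<Rightarrow> nat option) \<Rightarrow> bool" where
  "total_seq q \<longleftrightarrow> (\<forall>i. q i \<noteq> None)"

definition learns_tauSemWb_Sd_Bc :: "(nat \<Rightarrow> nat \<Rightarrow> nat option) \<Rightarrow> (nat \<Rightarrow> nat option) \<Rightarrow> nat set \<Rightarrow> bool" where
  "learns_tauSemWb_Sd_Bc \<phi> h L \<longleftrightarrow>
     (\<forall>T. total_seq (Sd h T) \<and> SemWb \<phi> (\<lambda>i. the (Sd h T i)) T) \<and>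
     (\<forall>T. content T = L \<longrightarrow> Bc \<phi> (\<lambda>i. the (Sd h T i)) T)"

definition learns_G_SemConv_Bc :: "(nat \<Rightarrow> nat \<Rightarrow> nat option) \<Rightarrow> (nat \<Rightarrow> nat option) \<Rightarrow> nat set \<Rightarrow> bool" where
  "learns_G_SemConv_Bc \<phi> h L \<longleftrightarrow>
     (\<forall>T. content T = L \<longrightarrow> total_seq (G h T) \<and>
        SemConv \<phi> (\<lambda>i. the (G h T i)) T \<and> Bc \<phi> (\<lambda>i. the (G h T i)) T)"

definition learnable_classes :: "((nat \<Rightarrow> nat option) \<Rightarrow> nat set \<Rightarrow> bool) \<Rightarrow> nat set set set" where
  "learnable_classes learns = {\<L>. \<exists>h. partial_computable h \<and> (\<forall>L\<in>\<L>. learns h L)}"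

end

theory Submission
  imports Defs
begin

text \<open>
  On a single text \<open>SemWb\<close> implies \<open>SemConv\<close>, and a set-driven learner is simulated by computing the
  content of a sequence. For the converse it suffices to assign to every finite set \<open>D\<close>, uniformly, a
  c.e. set \<open>hull D \<supseteq> D\<close> such that \<open>D \<subseteq> D' \<subseteq> hull D\<close> implies \<open>hull D' = hull D\<close>: consistency and
  conservativeness give \<open>SemWb\<close> on all texts.

  The given learner \<open>h\<close> is run on the canonical texts, which list \<open>i\<close> at time \<open>i\<close> if \<open>i \<in> D\<close> and pause
  otherwise. A prefix of length \<open>m\<close> depends only on the node \<open>(m, D \<inter> {..<m})\<close>, and conjectures \<open>U\<close> of
  nodes inside a language \<open>L\<close> learned by \<open>h\<close> change only if they are contradicted. Hence any node inside \<open>L\<close>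
  whose conjecture contains a locking prefix \<open>(n0, L \<inter> {..<n0})\<close> already conjectures \<open>L\<close>. A set \<open>D\<close>
  follows the shortest of its nodes that is seen to conjecture a superset of \<open>D\<close>. Since a shorter node may
  enumerate its conjecture more slowly than a longer one, this is organised in stages: a node may only
  absorb a longer one together with everything the latter has already enumerated, and each action of a
  node raises a barrier that the longer nodes below it must not cross before its next action. A node
  correct for \<open>L\<close> then acts infinitely often, and the finitely many incorrect nodes of \<open>L\<close> that act only
  finitely often restrain only finitely many finite sets.
\<close>

section \<open>Computable functions\<close>

lemma eval_Zero [simp]: "eval_recf Zero xs y \<longleftrightarrow> y = 0"
  by (auto intro: eval_recf.intros elim: eval_recf.cases)

lemma eval_Succ [simp]: "eval_recf Succ (x # xs) y \<longleftrightarrow> y = Suc x"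
  by (auto intro: eval_recf.intros elim: eval_recf.cases)

lemma eval_Succ_Nil [simp]: "\<not> eval_recf Succ [] y"
  by (auto elim: eval_recf.cases)

lemma eval_Proj [simp]: "eval_recf (Proj i) xs y \<longleftrightarrow> i < length xs \<and> y = xs ! i"
  by (auto intro: eval_recf.intros elim: eval_recf.cases)

lemma eval_Comp: "eval_recf (Comp f gs) xs z \<longleftrightarrow>
    (\<exists>ys. list_all2 (\<lambda>g y. eval_recf g xs y) gs ys \<and> eval_recf f ys z)"
  by (auto intro: eval_recf.intros elim: eval_recf.cases)

lemma eval_Prim_Nil [simp]: "\<not> eval_recf (Prim f g) [] y"
  by (auto elim: eval_recf.cases)

lemma eval_Prim_0 [simp]: "eval_recf (Prim f g) (0 # xs) y \<longleftrightarrow> eval_recf f xs y"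
  by (auto intro: eval_recf.intros elim: eval_recf.cases)

lemma eval_Prim_Suc: "eval_recf (Prim f g) (Suc n # xs) z \<longleftrightarrow>
    (\<exists>y. eval_recf (Prim f g) (n # xs) y \<and> eval_recf g (n # y # xs) z)"
  by (auto intro: eval_recf.intros elim: eval_recf.cases)

lemma eval_Mn: "eval_recf (Mn f) xs n \<longleftrightarrow>
    eval_recf f (n # xs) 0 \<and> (\<forall>m<n. \<exists>y. eval_recf f (m # xs) (Suc y))"
  by (auto intro: eval_recf.intros elim: eval_recf.cases)

definition computable :: "nat \<Rightarrow> (nat list \<Rightarrow> nat) \<Rightarrow> bool" where
  "computable k f \<longleftrightarrow> (\<exists>r. \<forall>xs y. length xs = k \<longrightarrow> (eval_recf r xs y \<longleftrightarrow> y = f xs))"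

definition decidable :: "nat \<Rightarrow> (nat list \<Rightarrow> bool) \<Rightarrow> bool" where
  "decidable k P \<longleftrightarrow> computable k (\<lambda>xs. of_bool (P xs))"

named_theorems computable_intros

lemma computable_cong: "computable k f \<Longrightarrow> (\<And>xs. length xs = k \<Longrightarrow> g xs = f xs) \<Longrightarrow> computable k g"
  unfolding computable_def by metis

lemma computable_compose:
  assumes f: "computable (length gs) f" and gs: "\<forall>g\<in>set gs. computable k g"
  shows "computable k (\<lambda>xs. f (map (\<lambda>g. g xs) gs))"
proof -
  obtain rf where rf: "\<And>xs y. length xs = length gs \<Longrightarrow> eval_recf rf xs y \<longleftrightarrow> y = f xs"
    using f unfolding computable_def by blast
  obtain R where R: "\<And>g xs y. g \<in> set gs \<Longrightarrow> length xs = k \<Longrightarrow> eval_recf (R g) xs y \<longleftrightarrow> y = g xs"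
    using gs unfolding computable_def by metis
  have "list_all2 (\<lambda>g y. eval_recf g xs y) (map R gs) ys \<longleftrightarrow> ys = map (\<lambda>g. g xs) gs"
    if "length xs = k" for xs ys
    using R that by (auto simp: list_all2_conv_all_nth list_eq_iff_nth_eq)
  then have "eval_recf (Comp rf (map R gs)) xs y \<longleftrightarrow> y = f (map (\<lambda>g. g xs) gs)" if "length xs = k" for xs y
    using that rf by (simp add: eval_Comp)
  then show ?thesis unfolding computable_def by blast
qed

lemma computable_nth [computable_intros]: "i < k \<Longrightarrow> computable k (\<lambda>xs. xs ! i)"
  unfolding computable_def by (rule exI[of _ "Proj i"]) auto

text \<open>Bounded sums and quantifiers put their variable in front of the arguments, and recursion
  puts two values there, so outer variables reappear behind one or two \<open>tl\<close>.\<close>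

lemma computable_tl_nth [computable_intros]: "Suc i < k \<Longrightarrow> computable k (\<lambda>xs. tl xs ! i)"
  by (rule computable_cong[OF computable_nth[of "Suc i"]]) (auto simp: nth_tl)

lemma computable_tl2_nth [computable_intros]: "Suc (Suc i) < k \<Longrightarrow> computable k (\<lambda>xs. tl (tl xs) ! i)"
  by (rule computable_cong[OF computable_nth[of "Suc (Suc i)"]]) (auto simp: nth_tl)

text \<open>Substitution rules: a function is proved computable once, in bare projections, and then
  used with arbitrary computable arguments.\<close>

lemma computable_comp1: "computable 1 (\<lambda>xs. f (xs ! 0)) \<Longrightarrow> computable k a \<Longrightarrow> computable k (\<lambda>xs. f (a xs))"
  using computable_compose[of "[a]" "\<lambda>xs. f (xs ! 0)" k] by simp

lemma computable_comp2: "computable 2 (\<lambda>xs. f (xs ! 0) (xs ! 1)) \<Longrightarrow> computable k a \<Longrightarrow> computable k b \<Longrightarrow> computable k (\<lambda>xs. f (a xs) (b xs))"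
  using computable_compose[of "[a, b]" "\<lambda>xs. f (xs ! 0) (xs ! 1)" k] by (simp add: numeral_2_eq_2)

lemma computable_comp3: "computable 3 (\<lambda>xs. f (xs ! 0) (xs ! 1) (xs ! 2)) \<Longrightarrow> computable k a \<Longrightarrow> computable k b \<Longrightarrow> computable k c
    \<Longrightarrow> computable k (\<lambda>xs. f (a xs) (b xs) (c xs))"
  using computable_compose[of "[a, b, c]" "\<lambda>xs. f (xs ! 0) (xs ! 1) (xs ! 2)" k] by (simp add: numeral_2_eq_2 numeral_3_eq_3)

lemma computable_comp5: "computable 5 (\<lambda>xs. f (xs ! 0) (xs ! 1) (xs ! 2) (xs ! 3) (xs ! 4)) \<Longrightarrow> computable k a \<Longrightarrow> computable k b
    \<Longrightarrow> computable k c \<Longrightarrow> computable k d \<Longrightarrow> computable k e \<Longrightarrow> computable k (\<lambda>xs. f (a xs) (b xs) (c xs) (d xs) (e xs))"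
  using computable_compose[of "[a, b, c, d, e]" "\<lambda>xs. f (xs ! 0) (xs ! 1) (xs ! 2) (xs ! 3) (xs ! 4)" k]
  by (simp add: eval_nat_numeral)

lemmas decidable_comp2 = computable_comp2[where f = "\<lambda>a b. of_bool (P a b)" for P, folded decidable_def]
lemmas decidable_comp3 = computable_comp3[where f = "\<lambda>a b c. of_bool (P a b c)" for P, folded decidable_def]
lemmas decidable_comp5 = computable_comp5[where f = "\<lambda>a b c d e. of_bool (P a b c d e)" for P, folded decidable_def]

lemma computable_rec:
  assumes a: "computable k a" and g: "computable (Suc (Suc k)) (\<lambda>ys. g (ys ! 0) (ys ! 1) (tl (tl ys)))" and n: "computable k n"
  shows "computable k (\<lambda>xs. rec_nat (a xs) (\<lambda>i y. g i y xs) (n xs))"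
proof -
  obtain ra where ra: "\<And>xs y. length xs = k \<Longrightarrow> eval_recf ra xs y \<longleftrightarrow> y = a xs"
    using a unfolding computable_def by blast
  obtain rg where rg: "\<And>xs y. length xs = Suc (Suc k) \<Longrightarrow>
      eval_recf rg xs y \<longleftrightarrow> y = g (xs ! 0) (xs ! 1) (tl (tl xs))"
    using g unfolding computable_def by blast
  have "eval_recf (Prim ra rg) (m # xs) y \<longleftrightarrow> y = rec_nat (a xs) (\<lambda>i y. g i y xs) m"
    if "length xs = k" for m xs y
    using that by (induction m arbitrary: y) (auto simp: ra rg eval_Prim_Suc)
  then have "computable (Suc k) (\<lambda>ys. rec_nat (a (tl ys)) (\<lambda>i y. g i y (tl ys)) (ys ! 0))"
    unfolding computable_def by (intro exI[of _ "Prim ra rg"]) (auto simp: length_Suc_conv)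
  \<comment> \<open>\<open>Prim\<close> recurses on its first argument, so it is fed
    \<open>n\<close> followed by all \<open>k\<close> projections, which rebuild
    \<open>xs\<close>.\<close>
  then have "computable k (\<lambda>xs. (\<lambda>ys. rec_nat (a (tl ys)) (\<lambda>i y. g i y (tl ys)) (ys ! 0))
      (map (\<lambda>g. g xs) (n # map (\<lambda>i xs. xs ! i) [0..<k])))"
    using n by (intro computable_compose) (auto intro: computable_nth)
  moreover have "map (\<lambda>g. g xs) (map (\<lambda>i xs. xs ! i) [0..<k]) = xs" if "length xs = k" for xs :: "nat list"
    using map_nth[of xs] that by (simp add: comp_def)
  ultimately show ?thesis
    by (elim computable_cong) (simp del: map_map)
qed

section \<open>Arithmetic, bounded sums and bounded quantifiers\<close>

lemma computable_Suc [computable_intros]: "computable k a \<Longrightarrow> computable k (\<lambda>xs. Suc (a xs))"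
proof (erule computable_comp1[rotated])
  show "computable 1 (\<lambda>xs. Suc (xs ! 0))"
    unfolding computable_def by (rule exI[of _ Succ]) (auto simp: length_Suc_conv)
qed

lemma computable_const [computable_intros]: "computable k (\<lambda>xs. c)"
proof (induction c)
  case 0
  show ?case unfolding computable_def by (rule exI[of _ Zero]) auto
qed (rule computable_Suc)

lemma computable_add [computable_intros]:
  assumes "computable k a" "computable k b" shows "computable k (\<lambda>xs. a xs + b xs)"
proof -
  have "rec_nat x (\<lambda>_ y. Suc y) n = x + n" for x n :: nat by (induction n) auto
  moreover have "computable k (\<lambda>xs. rec_nat (a xs) (\<lambda>_ y. Suc y) (b xs))"
    by (intro computable_rec computable_intros assms) auto
  ultimately show ?thesis by simp
qed

lemma computable_mult [computable_intros]:
  assumes "computable k a" "computable k b" shows "computable k (\<lambda>xs. a xs * b xs)"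
proof -
  have *: "rec_nat 0 (\<lambda>_ y. y + x) n = x * n" for x n :: nat by (induction n) auto
  have "computable 2 (\<lambda>xs. rec_nat 0 (\<lambda>_ y. y + xs ! 0) (xs ! 1))"
    by (intro computable_rec computable_intros) auto
  then show ?thesis using computable_comp2[of "(*)"] assms unfolding * by blast
qed

lemma computable_power [computable_intros]:
  assumes "computable k b" shows "computable k (\<lambda>xs. (2::nat) ^ b xs)"
proof -
  have *: "rec_nat 1 (\<lambda>_ y. y + y) n = (2::nat) ^ n" for n :: nat by (induction n) auto
  have "computable k (\<lambda>xs. rec_nat 1 (\<lambda>_ y. y + y) (b xs))"
    by (intro computable_rec computable_intros assms) auto
  then show ?thesis unfolding * .
qed

lemma computable_pred: "computable k a \<Longrightarrow> computable k (\<lambda>xs. a xs - 1)"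
proof -
  assume a: "computable k a"
  have *: "rec_nat 0 (\<lambda>i _. i) n = n - 1" for n :: nat by (induction n) auto
  have "computable k (\<lambda>xs. rec_nat 0 (\<lambda>i _. i) (a xs))"
    by (intro computable_rec computable_intros a) auto
  then show ?thesis unfolding * .
qed

lemma computable_diff [computable_intros]:
  assumes "computable k a" "computable k b" shows "computable k (\<lambda>xs. a xs - b xs)"
proof -
  have *: "rec_nat x (\<lambda>_ y. y - 1) n = x - n" for x n :: nat by (induction n) auto
  have "computable k (\<lambda>xs. rec_nat (a xs) (\<lambda>_ y. y - 1) (b xs))"
    by (intro computable_rec computable_pred computable_intros assms) auto
  then show ?thesis unfolding * .
qed

lemma decidable_le [computable_intros]: "computable k a \<Longrightarrow> computable k b \<Longrightarrow> decidable k (\<lambda>xs. a xs \<le> b xs)"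
  unfolding decidable_def by (rule computable_cong[of k "\<lambda>xs. 1 - (a xs - b xs)"]) (auto intro!: computable_intros)

lemma decidable_less [computable_intros]: "computable k a \<Longrightarrow> computable k b \<Longrightarrow> decidable k (\<lambda>xs. a xs < b xs)"
  using decidable_le[of k "\<lambda>xs. Suc (a xs)" b] computable_Suc by (simp add: Suc_le_eq)

lemma decidable_conj [computable_intros]: "decidable k P \<Longrightarrow> decidable k Q \<Longrightarrow> decidable k (\<lambda>xs. P xs \<and> Q xs)"
  unfolding decidable_def of_bool_conj by (rule computable_mult)

lemma decidable_not [computable_intros]: "decidable k P \<Longrightarrow> decidable k (\<lambda>xs. \<not> P xs)"
  unfolding decidable_def by (rule computable_cong[of k "\<lambda>xs. 1 - of_bool (P xs)"]) (auto intro!: computable_intros)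

lemma decidable_imp [computable_intros]: "decidable k P \<Longrightarrow> decidable k Q \<Longrightarrow> decidable k (\<lambda>xs. P xs \<longrightarrow> Q xs)"
  using decidable_not[OF decidable_conj[OF _ decidable_not], of k P Q] by simp

lemma decidable_disj [computable_intros]: "decidable k P \<Longrightarrow> decidable k Q \<Longrightarrow> decidable k (\<lambda>xs. P xs \<or> Q xs)"
  using decidable_imp[OF decidable_not, of k P Q] by (simp add: disj_imp)

lemma decidable_eq [computable_intros]: "computable k a \<Longrightarrow> computable k b \<Longrightarrow> decidable k (\<lambda>xs. a xs = b xs)"
  using decidable_conj[OF decidable_le decidable_le, of k a b b a] by (simp add: eq_iff)

lemma computable_of_bool [computable_intros]: "decidable k P \<Longrightarrow> computable k (\<lambda>xs. of_bool (P xs))"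
  unfolding decidable_def .

lemma computable_if [computable_intros]: "decidable k P \<Longrightarrow> computable k a \<Longrightarrow> computable k b \<Longrightarrow> computable k (\<lambda>xs. if P xs then a xs else b xs)"
  by (rule computable_cong[of k "\<lambda>xs. of_bool (P xs) * a xs + of_bool (\<not> P xs) * b xs"]) (auto intro!: computable_intros)

lemma computable_sum [computable_intros]:
  assumes "computable k n" "computable (Suc k) (\<lambda>ys. f (ys ! 0) (tl ys))"
  shows "computable k (\<lambda>xs. \<Sum>i<n xs. f i xs)"
proof -
  have *: "(\<Sum>i<m. f i xs) = rec_nat 0 (\<lambda>i y. y + f i xs) m" for m xs by (induction m) auto
  \<comment> \<open>In the recursion, position 1 holds the partial sum, which \<open>f\<close> does
    not take; the projections 0, 2, 3, ... skip it.\<close>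
  have "computable (Suc (Suc k)) (\<lambda>xs. (\<lambda>ys. f (ys ! 0) (tl ys))
      (map (\<lambda>g. g xs) (map (\<lambda>i xs. xs ! i) (0 # [2..<Suc (Suc k)]))))"
    using assms(2) by (intro computable_compose) (auto intro: computable_nth simp del: upt_Suc)
  then have "computable (Suc (Suc k)) (\<lambda>ys. f (ys ! 0) (tl (tl ys)))"
  proof (rule computable_cong)
    fix xs :: "nat list" assume "length xs = Suc (Suc k)"
    then have "map (\<lambda>g. g xs) (map (\<lambda>i xs. xs ! i) [2..<Suc (Suc k)]) = tl (tl xs)"
      by (auto simp: list_eq_iff_nth_eq nth_tl simp del: upt_Suc)
    then show "f (xs ! 0) (tl (tl xs)) = f (map (\<lambda>g. g xs) (map (\<lambda>i xs. xs ! i) (0 # [2..<Suc (Suc k)])) ! 0)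
        (tl (map (\<lambda>g. g xs) (map (\<lambda>i xs. xs ! i) (0 # [2..<Suc (Suc k)]))))"
      by (simp del: map_map upt_Suc)
  qed
  then show ?thesis unfolding * by (intro computable_rec computable_intros assms) auto
qed

lemma decidable_bex [computable_intros]:
  assumes "computable k n" "decidable (Suc k) (\<lambda>ys. P (ys ! 0) (tl ys))"
  shows "decidable k (\<lambda>xs. \<exists>i<n xs. P i xs)"
proof -
  have "(0 < (\<Sum>i<m. of_bool (P i xs) :: nat)) \<longleftrightarrow> (\<exists>i<m. P i xs)" for m xs
    by (auto simp: sum_eq_0_iff zero_less_iff_neq_zero Bex_def)
  moreover have "decidable k (\<lambda>xs. 0 < (\<Sum>i<n xs. of_bool (P i xs) :: nat))"
    using assms by (intro computable_intros) (auto simp: decidable_def)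
  ultimately show ?thesis by simp
qed

lemma decidable_ball [computable_intros]:
  assumes "computable k n" "decidable (Suc k) (\<lambda>ys. P (ys ! 0) (tl ys))"
  shows "decidable k (\<lambda>xs. \<forall>i<n xs. P i xs)"
  using decidable_not[OF decidable_bex[OF assms(1) decidable_not[OF assms(2)]]] by simp

text \<open>The quotient counts the positive multiples of \<open>b\<close> up to \<open>a\<close>;
  division by 0 has the value 0 and is split off.\<close>

lemma computable_div [computable_intros]:
  assumes "computable k a" "computable k b" shows "computable k (\<lambda>xs. a xs div b xs)"
proof -
  have *: "(if b = 0 then 0 else (\<Sum>i<a. of_bool (Suc i * b \<le> a))) = a div b" for a b :: nat
  proof (cases "b = 0")
    case False
    then have "{i. i < a \<and> Suc i * b \<le> a} = {..<a div b}"
      by (auto simp: less_eq_div_iff_mult_less_eq Suc_le_eq[symmetric] simp del: mult_Suc)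
        (meson div_le_dividend le_trans less_eq_div_iff_mult_less_eq not_gr_zero False Suc_le_eq)+
    then show ?thesis using False by (simp add: sum.If_cases of_bool_def Int_def del: mult_Suc)
  qed auto
  have "computable 2 (\<lambda>xs. if xs ! 1 = 0 then 0 else (\<Sum>i<xs ! 0. of_bool (Suc i * (xs ! 1) \<le> xs ! 0)))"
    by (intro computable_intros) auto
  then have "computable 2 (\<lambda>xs. xs ! 0 div xs ! 1)" unfolding * .
  then show ?thesis using computable_comp2[of "(div)"] assms by blast
qed

lemma computable_mod [computable_intros]:
  assumes "computable k a" "computable k b" shows "computable k (\<lambda>xs. a xs mod b xs)"
  unfolding minus_mult_div_eq_mod[symmetric] by (intro computable_intros assms)

lemma decidable_mem_set_decode [computable_intros]:
  assumes "computable k a" "computable k b" shows "decidable k (\<lambda>xs. a xs \<in> set_decode (b xs))"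
  unfolding set_decode_def mem_Collect_eq odd_iff_mod_2_eq_one by (intro computable_intros assms)

lemma computable_prod_encode [computable_intros]:
  assumes "computable k a" "computable k b" shows "computable k (\<lambda>xs. prod_encode (a xs, b xs))"
  unfolding prod_encode_def triangle_def split by (intro computable_intros assms)

text \<open>Decoding by bounded search: both components are at most the code, so exactly one index
  passes the test, and it contributes itself to the sum.\<close>

lemma computable_fst_prod_decode [computable_intros]:
  assumes "computable k a" shows "computable k (\<lambda>xs. fst (prod_decode (a xs)))"
proof -
  have "(\<Sum>i<Suc n. of_bool (\<exists>j<Suc n. prod_encode (i, j) = n) * i) = fst (prod_decode n)" for n
  proof -
    obtain a b where ab: "prod_decode n = (a, b)" by force
    then have n: "prod_encode (a, b) = n" by (metis prod_decode_inverse)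
    then have "a < Suc n" "b < Suc n" using le_prod_encode_1 le_prod_encode_2 by (auto simp: less_Suc_eq_le)
    then have "(\<exists>j<Suc n. prod_encode (i, j) = n) \<longleftrightarrow> i = a" for i
      using n by (metis prod_encode_inverse prod.inject)
    then show ?thesis using ab \<open>a < Suc n\<close> by simp
  qed
  moreover have "computable 1 (\<lambda>xs. \<Sum>i<Suc (xs ! 0). of_bool (\<exists>j<Suc (xs ! 0). prod_encode (i, j) = xs ! 0) * i)"
    by (intro computable_intros) auto
  ultimately show ?thesis using computable_comp1[of "\<lambda>n. fst (prod_decode n)"] assms by simp
qed

lemma computable_snd_prod_decode [computable_intros]:
  assumes "computable k a" shows "computable k (\<lambda>xs. snd (prod_decode (a xs)))"
proof -
  have "(\<Sum>i<Suc n. of_bool (\<exists>j<Suc n. prod_encode (j, i) = n) * i) = snd (prod_decode n)" for n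
  proof -
    obtain a b where ab: "prod_decode n = (a, b)" by force
    then have n: "prod_encode (a, b) = n" by (metis prod_decode_inverse)
    then have "a < Suc n" "b < Suc n" using le_prod_encode_1 le_prod_encode_2 by (auto simp: less_Suc_eq_le)
    then have "(\<exists>j<Suc n. prod_encode (j, i) = n) \<longleftrightarrow> i = b" for i
      using n by (metis prod_encode_inverse prod.inject)
    then show ?thesis using ab \<open>b < Suc n\<close> by simp
  qed
  moreover have "computable 1 (\<lambda>xs. \<Sum>i<Suc (xs ! 0). of_bool (\<exists>j<Suc (xs ! 0). prod_encode (j, i) = xs ! 0) * i)"
    by (intro computable_intros) auto
  ultimately show ?thesis using computable_comp1[of "\<lambda>n. snd (prod_decode n)"] assms by simp
qed

section \<open>Step-bounded evaluation\<close>

text \<open>\<open>fuel r t xs\<close> is \<open>Suc y\<close> if \<open>r\<close> halts on \<open>xs\<close> with value \<open>y\<close> within the search bound \<open>t\<close>, and \<open>0\<close>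
  otherwise; in the clause for \<open>Mn\<close> at most one summand is nonzero. For a fixed \<open>r\<close> this is a computable
  function of \<open>t\<close> and \<open>xs\<close>, so no universal function has to be programmed.\<close>

primrec fuel :: "recf \<Rightarrow> nat \<Rightarrow> nat list \<Rightarrow> nat" where
  "fuel Zero = (\<lambda>t xs. 1)"
| "fuel Succ = (\<lambda>t xs. if xs = [] then 0 else Suc (Suc (hd xs)))"
| "fuel (Proj i) = (\<lambda>t xs. if i < length xs then Suc (xs ! i) else 0)"
| "fuel (Comp f gs) = (\<lambda>t xs. let ys = map (\<lambda>F. F t xs) (map fuel gs) in
     if \<forall>y\<in>set ys. 0 < y then fuel f t (map (\<lambda>y. y - 1) ys) else 0)"
| "fuel (Prim f g) = (\<lambda>t xs. if xs = [] then 0 else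
     rec_nat (fuel f t (tl xs)) (\<lambda>n y. if y = 0 then 0 else fuel g t (n # (y - 1) # tl xs)) (hd xs))"
| "fuel (Mn f) = (\<lambda>t xs. \<Sum>n<t. if fuel f t (n # xs) = 1 \<and> (\<forall>m<n. 1 < fuel f t (m # xs)) then Suc n else 0)"

lemma fuel_Mn_iff: "fuel (Mn f) t xs = Suc n \<longleftrightarrow>
    n < t \<and> fuel f t (n # xs) = 1 \<and> (\<forall>m<n. 1 < fuel f t (m # xs))"
proof -
  let ?P = "\<lambda>n. fuel f t (n # xs) = 1 \<and> (\<forall>m<n. 1 < fuel f t (m # xs))"
  have uniq: "m = n" if "?P m" "?P n" for m n
    using that by (metis less_irrefl linorder_neqE_nat)
  have val: "fuel (Mn f) t xs = Suc n" if "n < t" "?P n" for n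
  proof -
    have "?P m \<longleftrightarrow> m = n" for m using uniq[OF that(2)] that(2) by blast
    then have "fuel (Mn f) t xs = (\<Sum>m<t. if m = n then Suc n else 0)"
      unfolding fuel.simps by (intro sum.cong) auto
    then show ?thesis using that by simp
  qed
  have "\<exists>m<t. ?P m" if "fuel (Mn f) t xs = Suc n"
  proof (rule ccontr)
    assume "\<not> ?thesis"
    then have "fuel (Mn f) t xs = 0" by (auto intro!: sum.neutral)
    with that show False by simp
  qed
  with val show ?thesis by (metis nat.inject)
qed

lemma fuel_Comp_iff: "fuel (Comp f gs) t xs = Suc z \<longleftrightarrow>
    (\<exists>ys. list_all2 (\<lambda>g y. fuel g t xs = Suc y) gs ys \<and> fuel f t ys = Suc z)"
proof -
  have "list_all2 (\<lambda>g y. fuel g t xs = Suc y) gs ys \<longleftrightarrow>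
      (\<forall>g\<in>set gs. 0 < fuel g t xs) \<and> ys = map (\<lambda>g. fuel g t xs - 1) gs" for ys
    by (induction gs arbitrary: ys) (auto simp: list_all2_Cons1 gr0_conv_Suc)
  then show ?thesis by (auto simp: Let_def comp_def split: if_splits)
qed

lemma fuel_Prim_0: "fuel (Prim f g) t (0 # xs) = fuel f t xs"
  by simp

lemma fuel_Prim_Suc: "fuel (Prim f g) t (Suc n # xs) = Suc z \<longleftrightarrow>
    (\<exists>y. fuel (Prim f g) t (n # xs) = Suc y \<and> fuel g t (n # y # xs) = Suc z)"
proof -
  have *: "fuel (Prim f g) t (n # xs) = rec_nat (fuel f t xs)
      (\<lambda>n y. if y = 0 then 0 else fuel g t (n # (y - 1) # xs)) n" for n
    by (simp only: fuel.simps list.sel list.distinct if_False)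
  show ?thesis by (cases "fuel (Prim f g) t (n # xs)") (simp_all add: * del: fuel.simps)
qed

text \<open>The clause for \<open>Mn\<close> certifies minimality by values found at all smaller
  arguments, not by failure to halt, so a larger bound preserves its result.\<close>

lemma fuel_mono: "fuel r t xs = Suc y \<Longrightarrow> t \<le> t' \<Longrightarrow> fuel r t' xs = Suc y"
proof (induction r arbitrary: xs y)
  case (Comp f gs)
  from Comp.prems(1) obtain ys where ys: "list_all2 (\<lambda>g y. fuel g t xs = Suc y) gs ys" "fuel f t ys = Suc y"
    unfolding fuel_Comp_iff by blast
  have "list_all2 (\<lambda>g y. fuel g t' xs = Suc y) gs ys"
    using ys(1) Comp.IH(2) Comp.prems(2) by (auto simp: list_all2_conv_all_nth)
  then show ?case using ys(2) Comp.IH(1) Comp.prems(2) unfolding fuel_Comp_iff by blast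
next
  case (Prim f g)
  then obtain n xs' where xs: "xs = n # xs'" by (cases xs) auto
  show ?case using Prim.prems(1) unfolding xs
  proof (induction n arbitrary: y)
    case 0
    then show ?case using Prim.IH(1) Prim.prems(2) unfolding fuel_Prim_0 by blast
  next
    case (Suc n)
    then show ?case using Prim.IH(2) Prim.prems(2) unfolding fuel_Prim_Suc by blast
  qed
next
  case (Mn f)
  have "1 < fuel f t' (m # xs)" if "1 < fuel f t (m # xs)" for m
    using that Mn.IH[of "m # xs" "fuel f t (m # xs) - 1"] Mn.prems(2) by simp
  then show ?case using Mn.prems Mn.IH[of "y # xs" 0] unfolding fuel_Mn_iff by auto
qed (auto split: if_splits)

lemma fuel_imp_eval: "fuel r t xs = Suc y \<Longrightarrow> eval_recf r xs y"
proof (induction r arbitrary: xs y)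
  case Succ
  then show ?case by (cases xs) auto
next
  case (Comp f gs)
  from Comp.prems obtain ys where ys: "list_all2 (\<lambda>g y. fuel g t xs = Suc y) gs ys" "fuel f t ys = Suc y"
    unfolding fuel_Comp_iff by blast
  have "list_all2 (\<lambda>g y. eval_recf g xs y) gs ys"
    using ys(1) Comp.IH(2) by (auto simp: list_all2_conv_all_nth)
  then show ?case using ys(2) Comp.IH(1) unfolding eval_Comp by blast
next
  case (Prim f g)
  then obtain n xs' where xs: "xs = n # xs'" by (cases xs) auto
  show ?case using Prim.prems unfolding xs
  proof (induction n arbitrary: y)
    case 0
    then show ?case using Prim.IH(1) unfolding fuel_Prim_0 by simp
  next
    case (Suc n)
    then show ?case using Prim.IH(2) unfolding fuel_Prim_Suc eval_Prim_Suc by blast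
  qed
next
  case (Mn f)
  then have y: "fuel f t (y # xs) = Suc 0" and less: "\<forall>m<y. 1 < fuel f t (m # xs)"
    unfolding fuel_Mn_iff by simp_all
  have "\<exists>z. eval_recf f (m # xs) (Suc z)" if "m < y" for m
  proof -
    have "1 < fuel f t (m # xs)" using less that by blast
    then have "fuel f t (m # xs) = Suc (Suc (fuel f t (m # xs) - 2))" by linarith
    then show ?thesis by (blast intro: Mn.IH)
  qed
  then show ?case using Mn.IH[OF y] unfolding eval_Mn by blast
qed (auto split: if_splits)

lemma ex_fuel_all:
  assumes "\<forall>i\<in>I. \<exists>t. fuel (r i) t (x i) = Suc (y i)" "finite I"
  shows "\<exists>t. \<forall>i\<in>I. fuel (r i) t (x i) = Suc (y i)"
proof -
  obtain T where T: "\<forall>i\<in>I. fuel (r i) (T i) (x i) = Suc (y i)" using assms(1) by metis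
  then have "\<forall>i\<in>I. fuel (r i) (\<Sum>i\<in>I. T i) (x i) = Suc (y i)"
    using assms(2) by (meson fuel_mono member_le_sum zero_le)
  then show ?thesis by blast
qed

lemma eval_imp_fuel: "eval_recf r xs y \<Longrightarrow> \<exists>t. fuel r t xs = Suc y"
proof (induction rule: eval_recf.induct)
  case (comp xs gs ys f z)
  have "\<forall>i\<in>{..<length gs}. \<exists>t. fuel (gs ! i) t xs = Suc (ys ! i)"
    using comp(1) by (auto simp: list_all2_conv_all_nth)
  then obtain t1 where t1: "\<forall>i\<in>{..<length gs}. fuel (gs ! i) t1 xs = Suc (ys ! i)"
    using ex_fuel_all[of "{..<length gs}" "\<lambda>i. gs ! i" "\<lambda>_. xs" "\<lambda>i. ys ! i"] by blast
  obtain t2 where t2: "fuel f t2 ys = Suc z" using comp by blast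
  have "fuel f (max t1 t2) ys = Suc z" "\<forall>i\<in>{..<length gs}. fuel (gs ! i) (max t1 t2) xs = Suc (ys ! i)"
    using t1 t2 by (auto intro: fuel_mono)
  then have "fuel (Comp f gs) (max t1 t2) xs = Suc z"
    unfolding fuel_Comp_iff using comp(1) by (auto simp: list_all2_conv_all_nth)
  then show ?case by blast
next
  case (primS f g n xs y z)
  then obtain t1 t2 where "fuel (Prim f g) t1 (n # xs) = Suc y" "fuel g t2 (n # y # xs) = Suc z"
    by blast
  then have "fuel (Prim f g) (max t1 t2) (n # xs) = Suc y" "fuel g (max t1 t2) (n # y # xs) = Suc z"
    by (auto intro: fuel_mono simp del: fuel.simps)
  then have "fuel (Prim f g) (max t1 t2) (Suc n # xs) = Suc z" unfolding fuel_Prim_Suc by blast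
  then show ?case by blast
next
  case (mn f n xs)
  then obtain t1 where t1: "fuel f t1 (n # xs) = Suc 0" by blast
  have "\<forall>m\<in>{..<n}. \<exists>y t. fuel f t (m # xs) = Suc (Suc y)" using mn by blast
  then obtain y where "\<forall>m\<in>{..<n}. \<exists>t. fuel f t (m # xs) = Suc (Suc (y m))" by metis
  then obtain t2 where t2: "\<forall>m\<in>{..<n}. fuel f t2 (m # xs) = Suc (Suc (y m))"
    using ex_fuel_all[of "{..<n}" "\<lambda>_. f" "\<lambda>m. m # xs" "\<lambda>m. Suc (y m)"] by blast
  \<comment> \<open>\<open>Suc n\<close> because the clause for \<open>Mn\<close> searches strictly
    below the bound.\<close>
  let ?t = "max (Suc n) (max t1 t2)"
  have "fuel f ?t (n # xs) = Suc 0" "\<forall>m\<in>{..<n}. fuel f ?t (m # xs) = Suc (Suc (y m))"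
    using t1 t2 by (auto intro: fuel_mono)
  then have "fuel (Mn f) ?t xs = Suc n" unfolding fuel_Mn_iff by auto
  then show ?case by blast
qed simp_all

lemma eval_iff_fuel: "eval_recf r xs y \<longleftrightarrow> (\<exists>t. fuel r t xs = Suc y)"
  using eval_imp_fuel fuel_imp_eval by blast

lemma computable_all_pos: "\<forall>f\<in>set fs. computable k f \<Longrightarrow> decidable k (\<lambda>xs. \<forall>f\<in>set fs. 0 < f xs)"
proof (induction fs)
  case Nil
  show ?case using computable_const[of k 1] by (simp add: decidable_def)
next
  case (Cons f fs)
  then have "decidable k (\<lambda>xs. 0 < f xs \<and> (\<forall>f\<in>set fs. 0 < f xs))" by (intro computable_intros) auto
  then show ?case by simp
qed

lemma computable_args:
  assumes "computable (length js) f" "\<forall>j\<in>set js. j < k"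
  shows "computable k (\<lambda>xs. f (map ((!) xs) js))"
  using computable_compose[of "map (\<lambda>j xs. xs ! j) js" f k] assms by (auto simp: comp_def intro: computable_nth)

lemma map_nth_upt: "map ((!) xs) [i..<length xs] = drop i xs"
  by (auto simp: list_eq_iff_nth_eq)

lemma computable_fuel: "computable (Suc k) (\<lambda>xs. fuel r (hd xs) (tl xs))"
proof (induction r arbitrary: k)
  case Zero
  show ?case using computable_const[of _ 1] by simp
next
  case Succ
  show ?case
  proof (cases k)
    case 0
    then show ?thesis by (auto intro!: computable_cong[OF computable_const[of _ 0]] simp: length_Suc_conv)
  next
    case (Suc k')
    have "computable (Suc k) (\<lambda>xs. Suc (Suc (xs ! 1)))" using Suc by (intro computable_intros) auto
    then show ?thesis using Suc by (elim computable_cong) (auto simp: length_Suc_conv)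
  qed
next
  case (Proj i)
  show ?case
  proof (cases "i < k")
    case True
    then have "computable (Suc k) (\<lambda>xs. Suc (xs ! Suc i))" by (intro computable_intros) auto
    then show ?thesis using True by (elim computable_cong) (auto simp: nth_tl)
  next
    case False
    then show ?thesis by (auto intro!: computable_cong[OF computable_const[of _ 0]])
  qed
next
  case (Comp f gs)
  let ?G = "map (\<lambda>g xs. fuel g (hd xs) (tl xs) - 1) gs"
  have "computable (Suc k) (\<lambda>xs. fuel f (hd (map (\<lambda>g. g xs) ((\<lambda>xs. xs ! 0) # ?G))) (tl (map (\<lambda>g. g xs) ((\<lambda>xs. xs ! 0) # ?G))))"
    using Comp.IH(1)[of "length gs"] Comp.IH(2)
    by (intro computable_compose) (auto intro!: computable_nth computable_pred[unfolded One_nat_def])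
  then have 1: "computable (Suc k) (\<lambda>xs. fuel f (hd xs) (map (\<lambda>g. fuel g (hd xs) (tl xs) - 1) gs))"
    by (rule computable_cong) (auto simp: comp_def hd_conv_nth length_Suc_conv)
  have 2: "decidable (Suc k) (\<lambda>xs. \<forall>F\<in>set (map (\<lambda>g xs. fuel g (hd xs) (tl xs)) gs). 0 < F xs)"
    using Comp.IH(2) by (intro computable_all_pos) auto
  have "computable (Suc k) (\<lambda>xs. if \<forall>F\<in>set (map (\<lambda>g xs. fuel g (hd xs) (tl xs)) gs). 0 < F xs
      then fuel f (hd xs) (map (\<lambda>g. fuel g (hd xs) (tl xs) - 1) gs) else 0)"
    by (rule computable_if[OF 2 1 computable_const])
  then show ?case by (rule computable_cong) (auto simp: Let_def comp_def)
next
  case (Prim f g)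
  show ?case
  proof (cases k)
    case 0
    then show ?thesis by (auto intro!: computable_cong[OF computable_const[of _ 0]] simp: length_Suc_conv)
  next
    case (Suc k')
    have 1: "computable (Suc k) (\<lambda>xs. fuel f (xs ! 0) (drop 2 xs))"
      by (rule computable_cong[OF computable_args[of "0 # [2..<Suc k]", OF _ ]])
        (use Prim.IH(1)[of k'] Suc in \<open>auto simp: map_nth_upt[symmetric] simp del: upt_Suc\<close>)
    \<comment> \<open>Layout of \<open>ys\<close>: counter, previous value, bound, recursion
      argument, parameters; so the parameters start at position 4.\<close>
    have 2: "computable (Suc (Suc (Suc k))) (\<lambda>ys. fuel g (ys ! 2) (ys ! 0 # (ys ! 1 - 1) # drop 4 ys))"
    proof -
      let ?fs = "[\<lambda>ys. ys ! 2, \<lambda>ys. ys ! 0, \<lambda>ys. ys ! 1 - 1] @ map (\<lambda>j ys. ys ! j) [4..<Suc (Suc (Suc k))]"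
      have "computable (Suc (Suc (Suc k))) (\<lambda>xs. fuel g (hd (map (\<lambda>g. g xs) ?fs)) (tl (map (\<lambda>g. g xs) ?fs)))"
        using Prim.IH(2)[of "Suc (Suc k')"] Suc
        by (intro computable_compose) (auto intro!: computable_nth computable_pred[unfolded One_nat_def] simp del: upt_Suc)
      then show ?thesis
        by (rule computable_cong) (auto simp: comp_def map_nth_upt[symmetric] simp del: upt_Suc)
    qed
    have "computable (Suc k) (\<lambda>xs. rec_nat (fuel f (xs ! 0) (drop 2 xs))
        (\<lambda>n y. if y = 0 then 0 else fuel g (xs ! 0) (n # (y - 1) # drop 2 xs)) (xs ! 1))"
    proof (rule computable_rec[OF 1])
      show "computable (Suc (Suc (Suc k))) (\<lambda>ys. if ys ! 1 = 0 then 0 else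
          fuel g (tl (tl ys) ! 0) (ys ! 0 # (ys ! 1 - 1) # drop 2 (tl (tl ys))))"
        by (intro computable_if decidable_eq computable_intros computable_cong[OF 2]) (auto simp: nth_tl numeral_2_eq_2 drop_Suc eval_nat_numeral)
    qed (use Suc in \<open>auto intro: computable_nth\<close>)
    then show ?thesis using Suc
      by (elim computable_cong) (auto simp: length_Suc_conv cong: if_cong)
  qed
next
  case (Mn f)
  let ?F = "\<lambda>xs. fuel f (hd xs) (tl xs)"
  \<comment> \<open>Here \<open>ys\<close> is the candidate, the bound and the arguments. Under the
    inner quantifier the tested value comes in front of these and shifts the bound to position
    2.\<close>
  have 1: "computable (Suc (Suc k)) (\<lambda>ys. fuel f (ys ! 1) (ys ! 0 # drop 2 ys))"
    by (rule computable_cong[OF computable_args[of "1 # 0 # [2..<Suc (Suc k)]" ?F]])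
      (use Mn[of "Suc k"] in \<open>auto simp: map_nth_upt[symmetric] simp del: upt_Suc\<close>)
  have 2: "computable (Suc (Suc (Suc k))) (\<lambda>ys. fuel f (ys ! 2) (ys ! 0 # drop 3 ys))"
    by (rule computable_cong[OF computable_args[of "2 # 0 # [3..<Suc (Suc (Suc k))]" ?F]])
      (use Mn[of "Suc k"] in \<open>auto simp: map_nth_upt[symmetric] simp del: upt_Suc\<close>)
  have 3: "decidable (Suc (Suc k)) (\<lambda>ys. \<forall>m<ys ! 0. 1 < fuel f (ys ! 1) (m # drop 2 ys))"
    by (intro decidable_ball decidable_less computable_const computable_nth computable_cong[OF 2])
      (auto simp: nth_tl numeral_2_eq_2 drop_Suc eval_nat_numeral)
  have "computable (Suc k) (\<lambda>xs. \<Sum>n<xs ! 0. if fuel f (xs ! 0) (n # drop 1 xs) = 1 \<and>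
      (\<forall>m<n. 1 < fuel f (xs ! 0) (m # drop 1 xs)) then Suc n else 0)"
  proof (rule computable_sum)
    show "computable (Suc (Suc k)) (\<lambda>ys. if fuel f (tl ys ! 0) (ys ! 0 # drop 1 (tl ys)) = 1 \<and>
        (\<forall>m<ys ! 0. 1 < fuel f (tl ys ! 0) (m # drop 1 (tl ys))) then Suc (ys ! 0) else 0)"
    proof (rule computable_cong)
      show "computable (Suc (Suc k)) (\<lambda>ys. if fuel f (ys ! 1) (ys ! 0 # drop 2 ys) = 1 \<and>
          (\<forall>m<ys ! 0. 1 < fuel f (ys ! 1) (m # drop 2 ys)) then Suc (ys ! 0) else 0)"
        by (intro computable_if decidable_conj decidable_eq 1 3 computable_Suc computable_const computable_nth) auto
    qed (auto simp: nth_tl drop_Suc eval_nat_numeral)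
  qed (auto intro: computable_nth)
  then show ?case by (rule computable_cong) (auto simp: drop_Suc length_Suc_conv)
qed

lemma computable_fuel1 [computable_intros]:
  assumes "computable k a" "computable k b" shows "computable k (\<lambda>xs. fuel r (a xs) [b xs])"
proof -
  have "computable (Suc 1) (\<lambda>xs. fuel r (xs ! 0) [xs ! 1])"
    by (rule computable_cong[OF computable_fuel]) (auto simp: length_Suc_conv)
  then show ?thesis using assms unfolding Suc_1 by (rule computable_comp2)
qed

section \<open>The staged construction\<close>

text \<open>The sets at stages with \<open>P\<close> form a chain, so of two stages that serve
  different elements the later one serves both.\<close>

lemma finite_subset_chain_member:
  assumes "finite B" "\<forall>x\<in>B. \<exists>s::nat. P s \<and> x \<in> F s" "\<exists>s. P s"
    and mono: "\<And>s t. s < t \<Longrightarrow> P s \<Longrightarrow> P t \<Longrightarrow> F s \<subseteq> F t"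
  shows "\<exists>s. P s \<and> B \<subseteq> F s"
  using assms(1,2)
proof (induction B rule: finite_induct)
  case empty
  then show ?case using assms(3) by blast
next
  case (insert x B)
  then obtain s t where st: "P s" "B \<subseteq> F s" "P t" "x \<in> F t" by blast
  then show ?case using mono[of s t] mono[of t s] by (cases s t rule: linorder_cases) blast+
qed

text \<open>Stage \<open>t\<close> treats the node \<open>(lev t, base t)\<close>, which stands for the initial segment of length \<open>lev t\<close>
  of the canonical text of \<open>base t\<close>; \<open>K m A t\<close> is the finite part of the conjecture \<open>U m A\<close> of the node
  \<open>(m, A)\<close> that is visible at time \<open>t\<close>. When the stage acts, every set \<open>D\<close> with \<open>base t \<subseteq> D \<subseteq> Fs t\<close> and
  \<open>D \<inter> {..<lev t} = base t\<close> is committed to contain \<open>Fs t\<close>. All commitments below a node made before its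
  last action at a stage \<open>s\<close> lie in \<open>{..<s}\<close>, and later ones of longer nodes whose base lies there must
  stay there; this is the barrier \<open>bar\<close>, and it gives a slow but correct node time to catch up.\<close>

locale stage_data =
  fixes lev :: "nat \<Rightarrow> nat" and base :: "nat \<Rightarrow> nat set"
    and K :: "nat \<Rightarrow> nat set \<Rightarrow> nat \<Rightarrow> nat set"
    and act :: "nat \<Rightarrow> bool" and Fs :: "nat \<Rightarrow> nat set"
begin

definition bar :: "nat \<Rightarrow> nat \<Rightarrow> nat set \<Rightarrow> nat set" where
  "bar t m A = {x. x < m \<or> (\<exists>s<t. act s \<and> lev s = m \<and> base s = A \<and> x < s)}"

definition V :: "nat \<Rightarrow> nat \<Rightarrow> nat set \<Rightarrow> nat set" where
  "V t m A = {x. \<exists>s<t. act s \<and> lev s = m \<and> base s = A \<and> x \<in> Fs s}"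

definition U :: "nat \<Rightarrow> nat set \<Rightarrow> nat set" where
  "U m A = (\<Union>t. K m A t)"

end

text \<open>A shorter node must, to act, absorb earlier commitments of longer nodes below it whose
  base it contains (\<open>act_iff\<close>); a longer node treated later is confined to what such a
  shorter node has committed (last clause of \<open>Fs_iff\<close>). Other stages are consulted only
  if they are earlier, so recursion on \<open>t\<close> realizes both.\<close>

locale stages = stage_data +
  assumes finite_base: "finite (base s)"
    and nodes: "finite A \<Longrightarrow> \<exists>s>k. lev s = m \<and> base s = A"
    and K_mono: "t \<le> t' \<Longrightarrow> K m A t \<subseteq> K m A t'"
    and act_iff: "act t \<longleftrightarrow> base t \<subseteq> {..<lev t} \<and> base t \<subseteq> Fs t \<and>
      (\<forall>s<t. act s \<and> lev t < lev s \<and> base s \<inter> {..<lev t} = base t \<and> base s \<subseteq> Fs t \<longrightarrow> Fs s \<subseteq> Fs t)"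
    and Fs_iff: "x \<in> Fs t \<longleftrightarrow> x < t \<and> x \<in> K (lev t) (base t) t \<and> (x < lev t \<longrightarrow> x \<in> base t) \<and>
      x \<in> bar t (lev t) (base t) \<and>
      (\<forall>m<lev t. base t \<subseteq> bar t m (base t \<inter> {..<m}) \<longrightarrow> x \<in> bar t m (base t \<inter> {..<m})) \<and>
      (\<forall>r<t. act r \<and> lev r < lev t \<and> base r = base t \<inter> {..<lev r} \<and> base t \<subseteq> Fs r \<longrightarrow>
         x \<in> V t (lev r) (base r))"
begin

definition hull :: "nat set \<Rightarrow> nat set" where
  "hull D = D \<union> \<Union>{Fs s | s. act s \<and> base s = D \<inter> {..<lev s} \<and> D \<subseteq> Fs s}"

definition lim :: "nat \<Rightarrow> nat set \<Rightarrow> nat set" where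
  "lim m A = \<Union>{Fs s | s. act s \<and> lev s = m \<and> base s = A}"

section \<open>Growth and absorption of commitments\<close>

lemma bar_mono: "t \<le> t' \<Longrightarrow> bar t m A \<subseteq> bar t' m A"
  unfolding bar_def by auto

lemma V_mono: "t \<le> t' \<Longrightarrow> V t m A \<subseteq> V t' m A"
  unfolding V_def by auto (metis order_less_le_trans)

lemma V_subset_lim: "V t m A \<subseteq> lim m A"
  unfolding V_def lim_def by blast

lemma bar_new: "x \<in> bar t' m A \<Longrightarrow> x \<notin> bar t m A \<Longrightarrow> \<exists>r\<ge>t. r < t' \<and> act r \<and> lev r = m \<and> base r = A"
  unfolding bar_def by auto (metis leI)

lemma act_bar: "act r \<Longrightarrow> r < t \<Longrightarrow> {..<r} \<subseteq> bar t (lev r) (base r)"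
  unfolding bar_def by auto

lemma act_V: "act r \<Longrightarrow> r < t \<Longrightarrow> Fs r \<subseteq> V t (lev r) (base r)"
  unfolding V_def by auto

lemma Fs_less_stage: "x \<in> Fs t \<Longrightarrow> x < t"
  and Fs_K: "x \<in> Fs t \<Longrightarrow> x \<in> K (lev t) (base t) t"
  and Fs_bar: "x \<in> Fs t \<Longrightarrow> x \<in> bar t (lev t) (base t)"
  and Fs_base: "x \<in> Fs t \<Longrightarrow> x < lev t \<Longrightarrow> x \<in> base t"
  and Fs_hindered: "x \<in> Fs t \<Longrightarrow> m < lev t \<Longrightarrow> base t \<subseteq> bar t m (base t \<inter> {..<m}) \<Longrightarrow>
    x \<in> bar t m (base t \<inter> {..<m})"
  and Fs_absorbed: "x \<in> Fs t \<Longrightarrow> r < t \<Longrightarrow> act r \<Longrightarrow> lev r < lev t \<Longrightarrow>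
    base r = base t \<inter> {..<lev r} \<Longrightarrow> base t \<subseteq> Fs r \<Longrightarrow> x \<in> V t (lev r) (base r)"
  using Fs_iff[of x t] by blast+

lemma FsI:
  assumes "x < t" "x \<in> K (lev t) (base t) t" "x < lev t \<Longrightarrow> x \<in> base t" "x \<in> bar t (lev t) (base t)"
    and "\<And>m. m < lev t \<Longrightarrow> base t \<subseteq> bar t m (base t \<inter> {..<m}) \<Longrightarrow> x \<in> bar t m (base t \<inter> {..<m})"
    and "\<And>r. r < t \<Longrightarrow> act r \<Longrightarrow> lev r < lev t \<Longrightarrow> base r = base t \<inter> {..<lev r} \<Longrightarrow> base t \<subseteq> Fs r \<Longrightarrow>
      x \<in> V t (lev r) (base r)"
  shows "x \<in> Fs t"
  using Fs_iff[of x t] assms by blast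

lemma Fs_less: "Fs s \<subseteq> {..<s}"
  using Fs_less_stage by auto

lemma Fs_U: "Fs s \<subseteq> U (lev s) (base s)"
  using Fs_K unfolding U_def by auto

lemma base_Fs: "act s \<Longrightarrow> base s \<subseteq> Fs s"
  using act_iff by blast

lemma act_base: "act s \<Longrightarrow> base s \<subseteq> {..<lev s}"
  using act_iff by blast

lemma act_absorbs:
  "act t \<Longrightarrow> s < t \<Longrightarrow> act s \<Longrightarrow> lev t < lev s \<Longrightarrow> base t = base s \<inter> {..<lev t} \<Longrightarrow> base s \<subseteq> Fs t \<Longrightarrow> Fs s \<subseteq> Fs t"
  using act_iff[of t] by simp

lemma Fs_mono:
  assumes st: "s < t" and s: "act s" and eq: "lev s = lev t" "base s = base t"
  shows "Fs s \<subseteq> Fs t"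
proof
  fix x assume x: "x \<in> Fs s"
  have lt: "x < s" using x by (rule Fs_less_stage)
  show "x \<in> Fs t"
  proof (rule FsI)
    show "x < t" using lt st by simp
    show "x \<in> K (lev t) (base t) t" using Fs_K[OF x] K_mono[of s t] st eq by auto
    show "x \<in> base t" if "x < lev t" using x that eq Fs_base by metis
    show "x \<in> bar t (lev t) (base t)" using act_bar[OF s st] lt eq by auto
  next
    fix m assume m: "m < lev t" and b: "base t \<subseteq> bar t m (base t \<inter> {..<m})"
    show "x \<in> bar t m (base t \<inter> {..<m})"
    proof (cases "base s \<subseteq> bar s m (base s \<inter> {..<m})")
      case True
      then have "x \<in> bar s m (base s \<inter> {..<m})" using Fs_hindered[OF x] m eq by simp
      then show ?thesis using bar_mono[of s t] st eq by auto
    next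
      case False
      then obtain r where r: "r \<ge> s" "r < t" "act r" "lev r = m" "base r = base t \<inter> {..<m}"
        using b eq bar_new[of _ t m "base t \<inter> {..<m}" s] unfolding eq subset_iff by blast
      then show ?thesis using act_bar[of r t] lt by auto
    qed
  next
    fix r assume r: "r < t" "act r" "lev r < lev t" "base r = base t \<inter> {..<lev r}" "base t \<subseteq> Fs r"
    show "x \<in> V t (lev r) (base r)"
    proof (cases r s rule: linorder_cases)
      case less
      then have "Fs s \<subseteq> V s (lev r) (base r)" using r eq by (intro subsetI Fs_absorbed) auto
      then show ?thesis using V_mono[of s t] st x by auto
    next
      case greater
      then have "Fs s \<subseteq> Fs r" using r eq s by (intro act_absorbs) auto
      then show ?thesis using act_V[of r t] r x by auto
    qed (use r eq in auto)
  qed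
qed

lemma finite_subset_lim:
  assumes "finite B" "B \<subseteq> lim m A" "act s" "lev s = m" "base s = A"
  shows "\<exists>r. act r \<and> lev r = m \<and> base r = A \<and> B \<subseteq> Fs r"
proof -
  have "\<exists>r. (act r \<and> lev r = m \<and> base r = A) \<and> B \<subseteq> Fs r"
    using assms by (intro finite_subset_chain_member Fs_mono) (auto simp: lim_def)
  then show ?thesis by blast
qed

lemma finite_subset_V:
  assumes "finite B" "B \<subseteq> V t m A" "act s" "s < t" "lev s = m" "base s = A"
  shows "\<exists>r<t. act r \<and> lev r = m \<and> base r = A \<and> B \<subseteq> Fs r"
proof -
  have "\<exists>r. (r < t \<and> act r \<and> lev r = m \<and> base r = A) \<and> B \<subseteq> Fs r"
    using assms by (intro finite_subset_chain_member Fs_mono) (auto simp: V_def)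
  then show ?thesis by blast
qed

text \<open>The finite base lies in \<open>Fs q\<close> for a single action \<open>q\<close> of the
  shorter node. If \<open>q\<close> is later than \<open>s\<close>, it absorbs \<open>Fs s\<close>;
  if it is earlier, stage \<open>s\<close> was confined to the commitments of the shorter
  node.\<close>

lemma absorb_V:
  assumes s: "act s" "s < t" and r: "act r" "r < t" and lt: "lev r < lev s" "base r = base s \<inter> {..<lev r}"
    and sub: "base s \<subseteq> V t (lev r) (base r)"
  shows "Fs s \<subseteq> V t (lev r) (base r)"
proof -
  obtain q where q: "q < t" "act q" "lev q = lev r" "base q = base r" "base s \<subseteq> Fs q"
    using finite_subset_V[OF finite_base sub r(1,2)] by auto
  show ?thesis
  proof (cases s q rule: linorder_cases)
    case less
    then have "Fs s \<subseteq> Fs q" using q s lt by (intro act_absorbs) auto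
    then show ?thesis using act_V[of q t] q by auto
  next
    case greater
    then have "Fs s \<subseteq> V s (lev q) (base q)" using q lt by (intro subsetI Fs_absorbed) auto
    then show ?thesis using V_mono[of s t] s q by auto
  qed (use q lt in auto)
qed

lemma absorb_lim:
  assumes s: "act s" and r: "act r" and lt: "lev r < lev s" "base r = base s \<inter> {..<lev r}"
    and sub: "base s \<subseteq> lim (lev r) (base r)"
  shows "Fs s \<subseteq> lim (lev r) (base r)"
proof -
  obtain q where q: "act q" "lev q = lev r" "base q = base r" "base s \<subseteq> Fs q"
    using finite_subset_lim[OF finite_base sub r] by auto
  have "base s \<subseteq> V (Suc (max s q)) (lev r) (base r)"
    using act_V[of q "Suc (max s q)"] q by (auto simp: less_Suc_eq_le)
  then have "Fs s \<subseteq> V (Suc (max s q)) (lev q) (base q)"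
    using s q lt by (intro absorb_V) auto
  then show ?thesis using V_subset_lim q by fastforce
qed

text \<open>Longer nodes covering \<open>D\<close> are absorbed by the shortest one. Conversely, two
  actions of one node are comparable, so each action of the shortest node either covers
  \<open>D\<close> itself or lies inside \<open>Fs s\<close>.\<close>

lemma hull_eq_lim:
  assumes s: "act s" "base s = D \<inter> {..<lev s}" "D \<subseteq> Fs s"
    and least: "\<And>r. act r \<Longrightarrow> base r = D \<inter> {..<lev r} \<Longrightarrow> D \<subseteq> Fs r \<Longrightarrow> lev s \<le> lev r"
  shows "hull D = lim (lev s) (base s)"
proof
  have D: "D \<subseteq> lim (lev s) (base s)" using s unfolding lim_def by blast
  have "Fs r \<subseteq> lim (lev s) (base s)" if r: "act r" "base r = D \<inter> {..<lev r}" "D \<subseteq> Fs r" for r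
  proof (cases "lev r = lev s")
    case True
    then show ?thesis using r s unfolding lim_def by auto
  next
    case False
    then have "lev s < lev r" using least[OF r] by simp
    then show ?thesis using s r D by (intro absorb_lim) auto
  qed
  then show "hull D \<subseteq> lim (lev s) (base s)" using D unfolding hull_def by blast
  show "lim (lev s) (base s) \<subseteq> hull D"
  proof
    fix x assume "x \<in> lim (lev s) (base s)"
    then obtain r where r: "act r" "lev r = lev s" "base r = base s" "x \<in> Fs r" unfolding lim_def by auto
    have "Fs s \<subseteq> Fs r \<or> Fs r \<subseteq> Fs s"
      using Fs_mono[OF _ s(1)] Fs_mono[OF _ r(1)] r(2,3) by (metis linorder_neqE_nat order_refl)
    then show "x \<in> hull D"
    proof
      assume "Fs s \<subseteq> Fs r"
      then have "act r" "base r = D \<inter> {..<lev r}" "D \<subseteq> Fs r" using r s by simp_all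
      then show ?thesis using r(4) unfolding hull_def by blast
    next
      assume "Fs r \<subseteq> Fs s"
      then show ?thesis using r(4) s unfolding hull_def by blast
    qed
  qed
qed

lemma subset_hull: "D \<subseteq> hull D"
  unfolding hull_def by simp

text \<open>The shortest covering node stays the same while \<open>D\<close> grows inside its hull:
  \<open>Fs\<close> admits nothing below the level outside the base, so \<open>D\<close> and
  \<open>D'\<close> agree below that level, and a shorter node covering \<open>D'\<close> would
  already cover \<open>D\<close>.\<close>

lemma hull_conservative:
  assumes "finite D'" "D \<subseteq> D'" "D' \<subseteq> hull D"
  shows "hull D' = hull D"
proof (cases "\<exists>s. act s \<and> base s = D \<inter> {..<lev s} \<and> D \<subseteq> Fs s")
  case False
  then have "hull D = D" unfolding hull_def by blast
  then show ?thesis using assms by auto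
next
  case True
  then obtain s0 where "act s0 \<and> base s0 = D \<inter> {..<lev s0} \<and> D \<subseteq> Fs s0" ..
  from ex_has_least_nat[of "\<lambda>s. act s \<and> base s = D \<inter> {..<lev s} \<and> D \<subseteq> Fs s", OF this, of lev]
  obtain s where s': "(act s \<and> base s = D \<inter> {..<lev s} \<and> D \<subseteq> Fs s) \<and>
      (\<forall>r. act r \<and> base r = D \<inter> {..<lev r} \<and> D \<subseteq> Fs r \<longrightarrow> lev s \<le> lev r)" ..
  then have s: "act s" "base s = D \<inter> {..<lev s}" "D \<subseteq> Fs s" by simp_all
  have least: "lev s \<le> lev r" if "act r" "base r = D \<inter> {..<lev r}" "D \<subseteq> Fs r" for r
    using s'[THEN conjunct2, rule_format, of r] that by simp
  have hD: "hull D = lim (lev s) (base s)" using s least by (rule hull_eq_lim)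
  obtain r where r: "act r" "lev r = lev s" "base r = base s" "D' \<subseteq> Fs r"
    using finite_subset_lim[OF assms(1) assms(3)[unfolded hD] s(1)] by auto
  have base_r: "base r = D' \<inter> {..<lev r}"
    using r s assms(2) Fs_base by fastforce
  have "hull D' = lim (lev r) (base r)"
  proof (rule hull_eq_lim[OF r(1) base_r r(4)])
    fix q assume q: "act q" "base q = D' \<inter> {..<lev q}" "D' \<subseteq> Fs q"
    show "lev r \<le> lev q"
    proof (rule ccontr)
      assume "\<not> ?thesis"
      then have "D' \<inter> {..<lev q} = D \<inter> {..<lev q}" using base_r r s by fastforce
      then show False using least[of q] q assms(2) r \<open>\<not> _\<close> by auto
    qed
  qed
  then show ?thesis using hD r by simp
qed

text \<open>Either the barrier enclosed the base already at \<open>s\<close>, and then stage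
  \<open>s\<close> respected it, or it was raised by an action not before \<open>s\<close>, and
  \<open>Fs s\<close> lies below \<open>s\<close>.\<close>

lemma bar_invariant:
  assumes s: "act s" "s < t" and m: "m < lev s" and sub: "base s \<subseteq> bar t m (base s \<inter> {..<m})"
  shows "Fs s \<subseteq> bar t m (base s \<inter> {..<m})"
proof (cases "base s \<subseteq> bar s m (base s \<inter> {..<m})")
  case True
  then have "Fs s \<subseteq> bar s m (base s \<inter> {..<m})" using m Fs_hindered by blast
  then show ?thesis using bar_mono[of s t] s by auto
next
  case False
  then obtain r where r: "r \<ge> s" "r < t" "act r" "lev r = m" "base r = base s \<inter> {..<m}"
    using sub bar_new[of _ t m "base s \<inter> {..<m}" s] unfolding subset_iff by blast
  then have "Fs s \<subseteq> {..<r}" using Fs_less[of s] by fastforce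
  then show ?thesis using act_bar[of r t] r by auto
qed

text \<open>\<open>L\<close> is a learned language: \<open>conv\<close> is what semantic conservativeness on texts of \<open>L\<close> says about nodes.\<close>

context
  fixes L :: "nat set" and n0 :: nat
  assumes conv: "\<And>D n m. D \<subseteq> L \<Longrightarrow> n \<le> m \<Longrightarrow> D \<inter> {..<m} \<subseteq> U n (D \<inter> {..<n}) \<Longrightarrow>
      U m (D \<inter> {..<m}) = U n (D \<inter> {..<n})"
    and n0: "U n0 (L \<inter> {..<n0}) = L"
    and least: "\<And>n. U n (L \<inter> {..<n}) = L \<Longrightarrow> n0 \<le> n"
begin

text \<open>Data from \<open>L\<close> never contradict the conjecture \<open>L\<close> of the
  locking prefix, so \<open>conv\<close> carries it to every extension inside
  \<open>L\<close>.\<close>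

lemma good_U:
  assumes "D \<subseteq> L" "D \<inter> {..<n0} = L \<inter> {..<n0}" "n0 \<le> m"
  shows "U m (D \<inter> {..<m}) = L"
  using conv[OF assms(1,3)] assms(1,2) n0 by auto

text \<open>Otherwise \<open>conv\<close> would identify the conjecture at \<open>m\<close> with
  that at \<open>n0\<close>, which is \<open>L\<close>, against the minimality of
  \<open>n0\<close>.\<close>

lemma bad_U:
  assumes "m < n0" shows "\<not> L \<inter> {..<n0} \<subseteq> U m (L \<inter> {..<m})"
  using conv[of L m n0] n0 least[of m] assms by auto

text \<open>Once \<open>D\<close> contains the locking prefix, its nodes below level
  \<open>n0\<close> are nodes of \<open>L\<close>, whose conjectures miss part of the prefix by
  \<open>bad_U\<close>; so only correct nodes can cover \<open>D\<close>.\<close>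

lemma good_node:
  assumes D: "D \<subseteq> L" "L \<inter> {..<n0} \<subseteq> D" and s: "act s" "base s = D \<inter> {..<lev s}" "D \<subseteq> Fs s"
  shows "n0 \<le> lev s" "Fs s \<subseteq> L"
proof -
  have D0: "D \<inter> {..<n0} = L \<inter> {..<n0}" using D by auto
  show *: "n0 \<le> lev s"
  proof (rule ccontr)
    assume "\<not> ?thesis"
    then have "base s = L \<inter> {..<lev s}" using D0 s by fastforce
    then show False using bad_U[of "lev s"] \<open>\<not> _\<close> Fs_U[of s] s(3) D by auto
  qed
  show "Fs s \<subseteq> L" using good_U[OF D(1) D0 *] Fs_U[of s] s by auto
qed

lemma hull_subset:
  assumes "D \<subseteq> L" "L \<inter> {..<n0} \<subseteq> D" shows "hull D \<subseteq> L"
  using good_node[OF assms] assms(1) unfolding hull_def by blast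

text \<open>If the actions stopped at \<open>k\<close>, the barrier would stay below
  \<open>m + k\<close>. Everything the node has to absorb would then lie in the finite set
  \<open>?Y\<close>, which its correct conjecture eventually shows, and a late stage would act after
  all.\<close>

lemma good_acts:
  assumes m: "n0 \<le> m"
  shows "\<exists>s>k. act s \<and> lev s = m \<and> base s = L \<inter> {..<m}"
proof (rule ccontr)
  let ?A = "L \<inter> {..<m}"
  assume "\<not> ?thesis"
  then have no: "s \<le> k" if "act s" "lev s = m" "base s = ?A" for s using that \<open>\<not> _\<close> not_le by blast
  have bar_sub: "bar t m ?A \<subseteq> {..<m + k}" for t
    unfolding bar_def using no by fastforce
  let ?Y = "L \<inter> {..<m + k}"
  have U: "U m ?A = L" using good_U[of L m] m by simp
  have "\<exists>t. ?Y \<subseteq> K m ?A t"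
  proof -
    have "\<exists>t. True \<and> ?Y \<subseteq> K m ?A t"
      using U K_mono by (intro finite_subset_chain_member) (auto simp: U_def)
    then show ?thesis by simp
  qed
  then obtain t0 where t0: "?Y \<subseteq> K m ?A t0" by blast
  obtain t where t: "t > t0 + m + k" "lev t = m" "base t = ?A" using nodes[of ?A "t0 + m + k" m] by auto
  have Y: "?Y \<subseteq> K m ?A t" using t0 K_mono[of t0 t] t by force
  have base: "base t \<subseteq> Fs t"
  proof
    fix x assume x: "x \<in> base t"
    show "x \<in> Fs t"
    proof (rule FsI)
      show "x \<in> bar t (lev t) (base t)" using x t unfolding bar_def by auto
      show "x \<in> V t (lev r) (base r)" if "r < t" "act r" "base t \<subseteq> Fs r" for r
        using act_V[of r t] that x by auto
    qed (use x t Y in auto)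
  qed
  have "Fs s \<subseteq> Fs t"
    if s: "s < t" "act s" "lev t < lev s" "base s \<inter> {..<lev t} = base t" "base s \<subseteq> Fs t" for s
  proof
    fix x assume x: "x \<in> Fs s"
    \<comment> \<open>The base of the longer node lies in \<open>Fs t\<close> and hence in
      \<open>L\<close>; that node extends the locking prefix inside \<open>L\<close>, so its
      conjecture is \<open>L\<close> too.\<close>
    have sL: "base s \<subseteq> L" using s(5) Fs_U[of t] t U by auto
    have bs: "base s = base s \<inter> {..<lev s}" using act_base[OF s(2)] by auto
    have "base s \<inter> {..<n0} = base s \<inter> {..<lev t} \<inter> {..<n0}" using m t(2) by auto
    also have "\<dots> = base t \<inter> {..<n0}" unfolding s(4) ..
    also have "\<dots> = L \<inter> {..<n0}" unfolding t(3) using m by auto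
    finally have "U (lev s) (base s \<inter> {..<lev s}) = L"
      using good_U[OF sL] s(3) t(2) m by simp
    then have xL: "x \<in> L" using x Fs_U[of s] bs by auto
    have "base s \<subseteq> bar t (lev t) (base s \<inter> {..<lev t})" using s(4,5) Fs_bar[of _ t] by auto
    then have xb: "x \<in> bar t (lev t) (base t)" using bar_invariant[OF s(2,1,3)] x s(4) by auto
    then have xY: "x \<in> ?Y" using bar_sub[of t] xL unfolding t(2,3) by blast
    show "x \<in> Fs t"
    proof (rule FsI)
      show "x < t" "x \<in> K (lev t) (base t) t" using xY Y t by auto
      show "x \<in> base t" if "x < lev t" using x xY that t by auto
      show "x \<in> bar t (lev t) (base t)" by (rule xb)
    next
      \<comment> \<open>The remaining filters admit \<open>base s\<close>, which is part of
        \<open>Fs t\<close>; \<open>bar_invariant\<close> and \<open>absorb_V\<close> extend this to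
        \<open>Fs s\<close>.\<close>
      fix m' assume m': "m' < lev t" and b: "base t \<subseteq> bar t m' (base t \<inter> {..<m'})"
      have eq: "base s \<inter> {..<m'} = base t \<inter> {..<m'}" using m' unfolding s(4)[symmetric] by auto
      have "base s \<subseteq> bar t m' (base s \<inter> {..<m'})" using s(5) Fs_hindered[OF _ m' b] eq by auto
      then show "x \<in> bar t m' (base t \<inter> {..<m'})" using bar_invariant[OF s(2,1), of m'] m' s(3) x unfolding eq by auto
    next
      fix r assume r: "r < t" "act r" "lev r < lev t" "base r = base t \<inter> {..<lev r}" "base t \<subseteq> Fs r"
      then have "base s \<subseteq> V t (lev r) (base r)" using s(5) Fs_absorbed[OF _ r] by blast
      moreover have "base r = base s \<inter> {..<lev r}" using r s(4) by auto
      ultimately show "x \<in> V t (lev r) (base r)" using absorb_V[of s t r] s r x by auto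
    qed
  qed
  then have "act t" unfolding act_iff[of t] using base t by auto
  then show False using no[of t] t by simp
qed

text \<open>Beyond \<open>b\<close>, incorrect nodes that act only finitely often no longer restrain anything.\<close>

lemma ex_unhindered: "\<exists>b. \<forall>m y. y \<ge> b \<longrightarrow> (\<exists>t. y \<in> bar t m (L \<inter> {..<m})) \<longrightarrow> m < n0 \<longrightarrow>
    (\<forall>k. \<exists>s>k. act s \<and> lev s = m \<and> base s = L \<inter> {..<m})"
proof -
  define unb where "unb m \<longleftrightarrow> (\<forall>k. \<exists>s>k. act s \<and> lev s = m \<and> base s = L \<inter> {..<m})" for m
  have "\<exists>b. \<not> unb m \<longrightarrow> (\<forall>s. act s \<longrightarrow> lev s = m \<longrightarrow> base s = L \<inter> {..<m} \<longrightarrow> s \<le> b)" for m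
    unfolding unb_def by (meson not_le)
  then obtain B where B: "\<And>m s. \<not> unb m \<Longrightarrow> act s \<Longrightarrow> lev s = m \<Longrightarrow> base s = L \<inter> {..<m} \<Longrightarrow> s \<le> B m"
    by metis
  \<comment> \<open>A barrier reaches up to its level or to a stage of action: \<open>n0\<close>
    dominates the levels, the sum every last action \<open>B m\<close>.\<close>
  show ?thesis
  proof (rule exI[of _ "n0 + (\<Sum>m<n0. B m)"], intro allI impI)
    fix m y k assume y: "n0 + (\<Sum>m<n0. B m) \<le> y" "\<exists>t. y \<in> bar t m (L \<inter> {..<m})" and m: "m < n0"
    have "unb m"
    proof (rule ccontr)
      assume ni: "\<not> unb m"
      have "B m \<le> (\<Sum>m<n0. B m)" using m by (intro member_le_sum) auto
      moreover have "y < m \<or> y < B m" using y(2) B[OF ni] unfolding bar_def by fastforce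
      ultimately show False using y(1) m by linarith
    qed
    then show "\<exists>s>k. act s \<and> lev s = m \<and> base s = L \<inter> {..<m}" unfolding unb_def by blast
  qed
qed

text \<open>For infinite \<open>L\<close>, the shortest node of \<open>L\<close> covering a long
  initial part of \<open>L\<close> enumerates all of \<open>L\<close>: no shorter node of
  \<open>L\<close> covers its base, and barriers of shorter nodes enclosing its base rise forever.
  It then covers every large finite \<open>D\<close>.\<close>

lemma hull_eq:
  obtains m where "\<And>D. finite D \<Longrightarrow> D \<subseteq> L \<Longrightarrow> L \<inter> {..<m} \<subseteq> D \<Longrightarrow> hull D = L"
proof (cases "finite L")
  case True
  then obtain M where M: "L \<subseteq> {..<M}" using finite_nat_set_iff_bounded by auto
  have "hull D = L" if "D \<subseteq> L" "L \<inter> {..<M} \<subseteq> D" for D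
  proof -
    have "D = L" using that M by blast
    then show ?thesis using hull_subset[of L] subset_hull[of L] by blast
  qed
  with that show ?thesis by blast
next
  case False
  obtain b where b: "\<And>m y t k. y \<ge> b \<Longrightarrow> y \<in> bar t m (L \<inter> {..<m}) \<Longrightarrow> m < n0 \<Longrightarrow>
      \<exists>s>k. act s \<and> lev s = m \<and> base s = L \<inter> {..<m}"
    using ex_unhindered by metis
  \<comment> \<open>A shorter barrier that encloses the base of the node chosen below also encloses
    \<open>y\<close>; as \<open>y\<close> is at least \<open>b\<close>, a node of level below
    \<open>n0\<close> with such a barrier acts infinitely often.\<close>
  obtain y where y: "y \<in> L" "y \<ge> b + n0" using False finite_nat_set_iff_bounded[of L] by (metis not_le)
  define M where "M = Suc y"
  let ?A = "L \<inter> {..<M}"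
  let ?P = "\<lambda>r. act r \<and> lev r \<le> M \<and> base r = L \<inter> {..<lev r} \<and> ?A \<subseteq> Fs r"
  have y_A: "y \<in> ?A" using y M_def by simp
  have M_n0: "n0 \<le> M" using y M_def by simp
  obtain s0 where "?P s0" using good_acts[of M 0] M_n0 base_Fs by (metis order_refl)
  then obtain r where r: "?P r" and r_least: "\<And>q. ?P q \<Longrightarrow> lev r \<le> lev q"
    using ex_has_least_nat[of ?P s0 lev] by blast
  let ?m = "lev r"
  have m_n0: "n0 \<le> ?m"
    by (rule good_node[of ?A r]) (use r M_n0 in auto)
  \<comment> \<open>Such a \<open>q\<close> would absorb \<open>Fs r\<close> and thus cover
    \<open>?A\<close>, against the choice of \<open>r\<close> as shortest.\<close>
  have not_absorbed: False
    if q: "act q" "lev q < ?m" "base q = L \<inter> {..<lev q}" "L \<inter> {..<?m} \<subseteq> Fs q" for q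
  proof -
    have "base r \<subseteq> lim (lev q) (base q)" using q r unfolding lim_def by auto
    then have "Fs r \<subseteq> lim (lev q) (base q)" using q r by (intro absorb_lim) auto
    then have "?A \<subseteq> lim (lev q) (base q)" using r by blast
    then obtain p where "act p" "lev p = lev q" "base p = base q" "?A \<subseteq> Fs p"
      using finite_subset_lim[OF _ _ q(1), of ?A "lev q" "base q"] by auto
    then show False using r_least[of p] q r by auto
  qed
  have "L \<subseteq> lim ?m (L \<inter> {..<?m})"
  proof
    fix x assume x: "x \<in> L"
    have inf: "\<exists>s>k. act s \<and> lev s = m \<and> base s = L \<inter> {..<m}"
      if "m < ?m" "L \<inter> {..<?m} \<subseteq> bar t m (L \<inter> {..<m})" for m t k
    proof (cases "m < n0")
      case True
      let ?t = "Suc (max t r)"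
      have eq: "base r \<inter> {..<m} = L \<inter> {..<m}" using r that(1) by auto
      have "base r \<subseteq> bar ?t m (base r \<inter> {..<m})" using that(2) bar_mono[of t ?t] r unfolding eq by fastforce
      then have "Fs r \<subseteq> bar ?t m (base r \<inter> {..<m})" using r that(1) by (intro bar_invariant) auto
      then have "y \<in> bar ?t m (L \<inter> {..<m})" using r y_A unfolding eq by blast
      then show ?thesis using b[of y] y True by auto
    qed (use good_acts in auto)
    \<comment> \<open>The actions \<open>S m\<close> do not depend on \<open>t\<close>, so the stage
      can afterwards be taken past all of them.\<close>
    obtain S where S: "\<And>m. x < S m" "\<And>m t. m < ?m \<Longrightarrow> L \<inter> {..<?m} \<subseteq> bar t m (L \<inter> {..<m}) \<Longrightarrow>
        act (S m) \<and> lev (S m) = m \<and> base (S m) = L \<inter> {..<m}"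
    proof -
      have "\<exists>s>x. \<forall>t. m < ?m \<longrightarrow> L \<inter> {..<?m} \<subseteq> bar t m (L \<inter> {..<m}) \<longrightarrow>
        act s \<and> lev s = m \<and> base s = L \<inter> {..<m}" for m
        using inf[of m _ x] by (cases "\<exists>t. m < ?m \<and> L \<inter> {..<?m} \<subseteq> bar t m (L \<inter> {..<m})") blast+
      then show ?thesis using that by metis
    qed
    have "x \<in> U ?m (L \<inter> {..<?m})" using good_U[of L ?m] m_n0 x by simp
    then obtain t0 where t0: "x \<in> K ?m (L \<inter> {..<?m}) t0" unfolding U_def by blast
    obtain p where p: "p > x" "act p" "lev p = ?m" "base p = L \<inter> {..<?m}" using good_acts[OF m_n0] by blast
    obtain t where t: "t > t0 + p + (\<Sum>m<?m. S m)" "act t" "lev t = ?m" "base t = L \<inter> {..<?m}"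
      using good_acts[OF m_n0] by blast
    have "x \<in> Fs t"
    proof (rule FsI)
      show "x < t" using t p by simp
      show "x \<in> K (lev t) (base t) t" using t t0 K_mono[of t0 t] by auto
      show "x \<in> base t" if "x < lev t" using t that x by simp
      show "x \<in> bar t (lev t) (base t)" using act_bar[of p t] p t by auto
    next
      fix m assume m: "m < lev t" "base t \<subseteq> bar t m (base t \<inter> {..<m})"
      have eq: "base t \<inter> {..<m} = L \<inter> {..<m}" using t m by auto
      have s: "act (S m)" "lev (S m) = m" "base (S m) = L \<inter> {..<m}"
        using S(2)[of m t] m eq t by auto
      have "S m \<le> (\<Sum>m<?m. S m)" using m t by (intro member_le_sum) auto
      then have "S m < t" using t by simp
      then show "x \<in> bar t m (base t \<inter> {..<m})" using act_bar[of "S m" t] s S(1)[of m] eq by auto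
    next
      fix q assume q: "q < t" "act q" "lev q < lev t" "base q = base t \<inter> {..<lev q}" "base t \<subseteq> Fs q"
      have "base q = L \<inter> {..<lev q}" unfolding q(4) t(4) using q(3) t(3) by auto
      then have False using not_absorbed[of q] q unfolding t(3,4) by blast
      then show "x \<in> V t (lev q) (base q)" ..
    qed
    then show "x \<in> lim ?m (L \<inter> {..<?m})" using t unfolding lim_def by auto
  qed
  then have "hull D = L" if D: "finite D" "D \<subseteq> L" "L \<inter> {..<M} \<subseteq> D" for D
  proof -
    have Dm: "D \<inter> {..<?m} = L \<inter> {..<?m}" using D r by fastforce
    have "L \<subseteq> hull D"
    proof
      fix x assume x: "x \<in> L"
      \<comment> \<open>Adding \<open>x\<close> to the finite set \<open>D\<close> first yields one
        action that covers \<open>D\<close> and contains \<open>x\<close>.\<close>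
      have "insert x D \<subseteq> lim ?m (L \<inter> {..<?m})" using \<open>L \<subseteq> lim _ _\<close> x D by blast
      then obtain q where q: "act q" "lev q = ?m" "base q = L \<inter> {..<?m}" "insert x D \<subseteq> Fs q"
        using finite_subset_lim[of "insert x D" ?m "L \<inter> {..<?m}" r] D(1) r by auto
      then have "base q = D \<inter> {..<lev q}" using Dm by simp
      then show "x \<in> hull D" using q unfolding hull_def by blast
    qed
    moreover have "hull D \<subseteq> L" using hull_subset[of D] D M_n0 by fastforce
    ultimately show ?thesis by blast
  qed
  with that show ?thesis by blast
qed

end

end

section \<open>Computing the construction\<close>

lemma set_decode_mod: "set_decode (a mod 2 ^ m) = set_decode a \<inter> {..<m}"
  by (auto simp: set_decode_def bit_take_bit_iff simp flip: bit_iff_odd take_bit_eq_mod)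

lemma set_decode_eq_iff: "set_decode a = set_decode b \<longleftrightarrow> a = b"
  by (metis set_decode_inverse)

lemma set_decode_less: "y \<in> set_decode a \<Longrightarrow> y < a"
proof -
  assume "y \<in> set_decode a"
  then have "a div 2 ^ y \<noteq> 0" by (auto simp: set_decode_def elim: oddE)
  then have "2 ^ y \<le> a" by (simp add: div_eq_0_iff)
  then show "y < a" using less_exp[of y] by linarith
qed

lemma computable_tl: "computable k a \<Longrightarrow> computable (Suc k) (\<lambda>ys. a (tl ys))"
proof -
  assume a: "computable k a"
  have *: "map ((!) xs) [1..<Suc k] = tl xs" if "length xs = Suc k" for xs :: "nat list"
    using map_nth_upt[of xs 1] that by (simp add: drop_Suc del: upt_Suc)
  show ?thesis
    by (rule computable_cong[OF computable_args[of "[1..<Suc k]" a]]) (use a * in \<open>auto simp del: upt_Suc\<close>)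
qed

lemma decidable_ball_set_decode [computable_intros]:
  assumes "computable k a" "decidable (Suc k) (\<lambda>ys. P (ys ! 0) (tl ys))"
  shows "decidable k (\<lambda>xs. \<forall>y\<in>set_decode (a xs). P y xs)"
proof -
  have "decidable k (\<lambda>xs. \<forall>y<a xs. y \<in> set_decode (a xs) \<longrightarrow> P y xs)"
    by (intro computable_intros assms computable_tl) auto
  moreover have "(\<forall>y<a xs. y \<in> set_decode (a xs) \<longrightarrow> P y xs) \<longleftrightarrow> (\<forall>y\<in>set_decode (a xs). P y xs)" for xs
    using set_decode_less by blast
  ultimately show ?thesis by simp
qed

lemma computable_set_encode [computable_intros]:
  assumes "computable k b" "decidable (Suc k) (\<lambda>ys. Q (ys ! 0) (tl ys))"
  shows "computable k (\<lambda>xs. set_encode {y. y < b xs \<and> Q y xs})"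
proof -
  have "set_encode {y. y < b xs \<and> Q y xs} = (\<Sum>y<b xs. of_bool (Q y xs) * 2 ^ y)" for xs
    unfolding set_encode_def by (rule sum.mono_neutral_cong_left) auto
  moreover have "computable k (\<lambda>xs. \<Sum>y<b xs. of_bool (Q y xs) * 2 ^ y)"
    by (intro computable_intros assms) auto
  ultimately show ?thesis by simp
qed

section \<open>Codes of canonical texts, stages and histories\<close>

definition canon :: "nat set \<Rightarrow> ltext" where
  "canon D i = (if i \<in> D then Some i else None)"

definition canon_code :: "nat \<Rightarrow> nat \<Rightarrow> nat" where
  "canon_code m a = code_seq (seg (canon (set_decode a)) m)"

text \<open>A list code grows at its head, so the recursion runs backwards: step \<open>k\<close>
  prepends the entry at \<open>m - Suc k\<close>, with 0 for a pause.\<close>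

lemma canon_code_rec: "canon_code m a = rec_nat 0
    (\<lambda>k y. Suc (prod_encode (if m - Suc k \<in> set_decode a then Suc (m - Suc k) else 0, y))) m"
proof -
  let ?v = "\<lambda>i. case_option 0 Suc (canon (set_decode a) i)"
  have "rec_nat 0 (\<lambda>k y. Suc (prod_encode (if m - Suc k \<in> set_decode a then Suc (m - Suc k) else 0, y))) j
      = list_encode (map ?v [m - j..<m])" if "j \<le> m" for j
    using that
  proof (induction j)
    case (Suc j)
    then have "[m - Suc j..<m] = (m - Suc j) # [m - j..<m]" by (simp add: upt_conv_Cons Suc_diff_Suc)
    then show ?case using Suc by (simp add: canon_def)
  qed simp
  from this[of m] show ?thesis by (simp add: canon_code_def code_seq_def seg_def comp_def)
qed

lemma computable_canon_code:
  assumes "computable k a" "computable k b" shows "computable k (\<lambda>xs. canon_code (a xs) (b xs))"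
proof -
  have "computable 2 (\<lambda>xs. canon_code (xs ! 0) (xs ! 1))"
    unfolding canon_code_rec by (intro computable_rec computable_intros) auto
  then show ?thesis using assms by (rule computable_comp2)
qed

text \<open>A stage number codes a node together with a free component, which lets every node recur
  at arbitrarily late stages.\<close>

definition node_lev :: "nat \<Rightarrow> nat" where
  "node_lev s = fst (prod_decode (fst (prod_decode s)))"

definition node_code :: "nat \<Rightarrow> nat" where
  "node_code s = snd (prod_decode (fst (prod_decode s)))"

lemma computable_node [computable_intros]:
  assumes "computable k a" shows "computable k (\<lambda>xs. node_lev (a xs))" "computable k (\<lambda>xs. node_code (a xs))"
  unfolding node_lev_def node_code_def by (intro computable_intros assms)+

text \<open>A history is a code of a finite set: \<open>prod_encode (s, 0)\<close> records that stage \<open>s\<close> acted and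
  \<open>prod_encode (s, Suc x)\<close> that in addition \<open>x \<in> Fs s\<close>.\<close>

definition acted :: "nat \<Rightarrow> nat \<Rightarrow> bool" where
  "acted z s \<longleftrightarrow> prod_encode (s, 0) \<in> set_decode z"

definition records :: "nat \<Rightarrow> nat \<Rightarrow> nat \<Rightarrow> bool" where
  "records z s x \<longleftrightarrow> prod_encode (s, Suc x) \<in> set_decode z"

definition in_bar :: "nat \<Rightarrow> nat \<Rightarrow> nat \<Rightarrow> nat \<Rightarrow> nat \<Rightarrow> bool" where
  "in_bar z t m a x \<longleftrightarrow> x < m \<or> (\<exists>s<t. acted z s \<and> node_lev s = m \<and> node_code s = a \<and> x < s)"

definition in_V :: "nat \<Rightarrow> nat \<Rightarrow> nat \<Rightarrow> nat \<Rightarrow> nat \<Rightarrow> bool" where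
  "in_V z t m a x \<longleftrightarrow> (\<exists>s<t. acted z s \<and> node_lev s = m \<and> node_code s = a \<and> records z s x)"

lemma decidable_acted [computable_intros]:
  assumes "computable k a" "computable k b" shows "decidable k (\<lambda>xs. acted (a xs) (b xs))"
  unfolding acted_def by (intro computable_intros assms)

lemma decidable_records [computable_intros]:
  assumes "computable k a" "computable k b" "computable k c" shows "decidable k (\<lambda>xs. records (a xs) (b xs) (c xs))"
  unfolding records_def by (intro computable_intros assms)

lemma decidable_in_bar [computable_intros]:
  assumes "computable k a" "computable k b" "computable k c" "computable k d" "computable k e"
  shows "decidable k (\<lambda>xs. in_bar (a xs) (b xs) (c xs) (d xs) (e xs))"
proof -
  have "decidable 5 (\<lambda>xs. in_bar (xs ! 0) (xs ! 1) (xs ! 2) (xs ! 3) (xs ! 4))"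
    unfolding in_bar_def by (intro computable_intros) auto
  then show ?thesis using assms by (rule decidable_comp5)
qed

lemma decidable_in_V [computable_intros]:
  assumes "computable k a" "computable k b" "computable k c" "computable k d" "computable k e"
  shows "decidable k (\<lambda>xs. in_V (a xs) (b xs) (c xs) (d xs) (e xs))"
proof -
  have "decidable 5 (\<lambda>xs. in_V (xs ! 0) (xs ! 1) (xs ! 2) (xs ! 3) (xs ! 4))"
    unfolding in_V_def by (intro computable_intros) auto
  then show ?thesis using assms by (rule decidable_comp5)
qed

text \<open>\<open>rh\<close> and \<open>ru\<close> stand for programs of the given learner and of
  the uncurried numbering; \<open>U_eq_W\<close> makes this link.\<close>

locale stage_codes =
  fixes rh ru :: recf
begin

text \<open>One bound serves both for computing the conjecture and for confirming \<open>x\<close>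
  in it. A positive \<open>fuel\<close> value is the result plus 1, hence the subtraction.\<close>

definition approx :: "nat \<Rightarrow> nat \<Rightarrow> nat \<Rightarrow> nat \<Rightarrow> bool" where
  "approx m a t x \<longleftrightarrow> 0 < fuel rh t [canon_code m a] \<and>
     0 < fuel ru t [prod_encode (fuel rh t [canon_code m a] - 1, x)]"

definition in_F :: "nat \<Rightarrow> nat \<Rightarrow> nat \<Rightarrow> bool" where
  "in_F z t x \<longleftrightarrow> x < t \<and> approx (node_lev t) (node_code t) t x \<and>
     (x < node_lev t \<longrightarrow> x \<in> set_decode (node_code t)) \<and>
     in_bar z t (node_lev t) (node_code t) x \<and>
     (\<forall>m<node_lev t. (\<forall>y\<in>set_decode (node_code t). in_bar z t m (node_code t mod 2 ^ m) y) \<longrightarrow>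
        in_bar z t m (node_code t mod 2 ^ m) x) \<and>
     (\<forall>r<t. acted z r \<and> node_lev r < node_lev t \<and> node_code r = node_code t mod 2 ^ node_lev r \<and>
        (\<forall>y\<in>set_decode (node_code t). records z r y) \<longrightarrow> in_V z t (node_lev r) (node_code r) x)"

definition enters :: "nat \<Rightarrow> nat \<Rightarrow> bool" where
  "enters z t \<longleftrightarrow> (\<forall>y\<in>set_decode (node_code t). y < node_lev t) \<and>
     (\<forall>y\<in>set_decode (node_code t). in_F z t y) \<and>
     (\<forall>s<t. acted z s \<and> node_lev t < node_lev s \<and> node_code s mod 2 ^ node_lev t = node_code t \<and>
        (\<forall>y\<in>set_decode (node_code s). in_F z t y) \<longrightarrow> (\<forall>x<s. records z s x \<longrightarrow> in_F z t x))"

text \<open>Elements of \<open>z\<close> are smaller than \<open>z\<close>, and new codes have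
  second component at most \<open>t\<close>, so the bound leaves room for both.\<close>

definition step :: "nat \<Rightarrow> nat \<Rightarrow> nat" where
  "step z t = set_encode {y. y < z + Suc (prod_encode (t, t)) \<and> (y \<in> set_decode z \<or>
     enters z t \<and> fst (prod_decode y) = t \<and>
       (snd (prod_decode y) = 0 \<or> in_F z t (snd (prod_decode y) - 1)))}"

definition history :: "nat \<Rightarrow> nat" where
  "history t = rec_nat 0 (\<lambda>t z. step z t) t"

lemma decidable_approx [computable_intros]:
  assumes "computable k a" "computable k b" "computable k c" "computable k d"
  shows "decidable k (\<lambda>xs. approx (a xs) (b xs) (c xs) (d xs))"
  unfolding approx_def by (intro computable_intros computable_pred computable_canon_code assms)

lemma decidable_in_F [computable_intros]:
  assumes "computable k a" "computable k b" "computable k c"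
  shows "decidable k (\<lambda>xs. in_F (a xs) (b xs) (c xs))"
proof -
  have "decidable 3 (\<lambda>xs. in_F (xs ! 0) (xs ! 1) (xs ! 2))"
    unfolding in_F_def by (intro computable_intros) auto
  then show ?thesis using assms by (rule decidable_comp3)
qed

lemma decidable_enters [computable_intros]:
  assumes "computable k a" "computable k b"
  shows "decidable k (\<lambda>xs. enters (a xs) (b xs))"
proof -
  have "decidable 2 (\<lambda>xs. enters (xs ! 0) (xs ! 1))"
    unfolding enters_def by (intro computable_intros) auto
  then show ?thesis using assms by (rule decidable_comp2)
qed

lemma computable_history [computable_intros]:
  assumes "computable k a" shows "computable k (\<lambda>xs. history (a xs))"
proof -
  have "computable 2 (\<lambda>xs. step (xs ! 0) (xs ! 1))"
    unfolding step_def by (intro computable_intros) auto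
  note computable_step = computable_comp2[of step, OF this]
  have "computable k (\<lambda>xs. rec_nat 0 (\<lambda>t z. step z t) (a xs))"
    by (intro computable_rec computable_step computable_intros assms) auto
  then show ?thesis unfolding history_def .
qed

section \<open>The recorded stages satisfy the axioms of the construction\<close>

definition act :: "nat \<Rightarrow> bool" where
  "act t \<longleftrightarrow> enters (history t) t"

definition Fs :: "nat \<Rightarrow> nat set" where
  "Fs t = {x. in_F (history t) t x}"

definition K :: "nat \<Rightarrow> nat set \<Rightarrow> nat \<Rightarrow> nat set" where
  "K m A t = {x. approx m (set_encode A) t x}"

lemma prod_encode_mono: "j \<le> i \<Longrightarrow> prod_encode (t, j) \<le> prod_encode (t, i)"
  by (induction i rule: dec_induct) (simp_all add: prod_encode_def)

lemma history_Suc: "prod_encode (s, j) \<in> set_decode (history (Suc t)) \<longleftrightarrow>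
    prod_encode (s, j) \<in> set_decode (history t) \<or> act t \<and> s = t \<and> (j = 0 \<or> j - 1 \<in> Fs t)"
proof -
  have "prod_encode (s, j) \<in> set_decode (history (Suc t)) \<longleftrightarrow>
    prod_encode (s, j) < history t + Suc (prod_encode (t, t)) \<and> (prod_encode (s, j) \<in> set_decode (history t) \<or>
      act t \<and> s = t \<and> (j = 0 \<or> j - 1 \<in> Fs t))"
    by (simp add: history_def step_def act_def Fs_def)
  moreover have "prod_encode (s, j) < history t" if "prod_encode (s, j) \<in> set_decode (history t)"
    using that by (rule set_decode_less)
  moreover have "prod_encode (t, j) \<le> prod_encode (t, t)" if "j = 0 \<or> j - 1 \<in> Fs t"
    by (rule prod_encode_mono) (use that in \<open>auto simp: Fs_def in_F_def\<close>)
  ultimately show ?thesis by (auto simp: less_Suc_eq_le trans_le_add2)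
qed

lemma acted_history: "acted (history t) s \<longleftrightarrow> s < t \<and> act s"
proof (induction t)
  case 0
  then show ?case by (simp add: history_def acted_def)
next
  case (Suc t)
  then show ?case unfolding acted_def history_Suc by (auto simp: less_Suc_eq)
qed

lemma records_history: "records (history t) s x \<longleftrightarrow> s < t \<and> act s \<and> x \<in> Fs s"
proof (induction t)
  case 0
  then show ?case by (simp add: history_def records_def)
next
  case (Suc t)
  then show ?case unfolding records_def history_Suc by (auto simp: less_Suc_eq)
qed

lemma approx_mono:
  assumes "approx m a t x" "t \<le> t'" shows "approx m a t' x"
proof -
  from assms(1) obtain e where e: "fuel rh t [canon_code m a] = Suc e" "0 < fuel ru t [prod_encode (e, x)]"
    unfolding approx_def by (metis diff_Suc_1 gr0_conv_Suc)
  then obtain y where "fuel ru t [prod_encode (e, x)] = Suc y" using gr0_conv_Suc by blast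
  then show ?thesis using fuel_mono[OF _ assms(2)] e(1) unfolding approx_def by simp
qed

end

sublocale stage_codes \<subseteq> stage_data node_lev "\<lambda>s. set_decode (node_code s)" K act Fs .

context stage_codes
begin

lemma in_bar_history: "in_bar (history t) t m a x \<longleftrightarrow> x \<in> bar t m (set_decode a)"
  unfolding in_bar_def bar_def acted_history by (auto simp: set_decode_eq_iff)

lemma in_V_history: "in_V (history t) t m a x \<longleftrightarrow> x \<in> V t m (set_decode a)"
  unfolding in_V_def V_def acted_history records_history by (auto simp: set_decode_eq_iff)

lemma act_iff_enters: "act t \<longleftrightarrow>
    set_decode (node_code t) \<subseteq> {..<node_lev t} \<and> set_decode (node_code t) \<subseteq> Fs t \<and>
    (\<forall>s<t. act s \<and> node_lev t < node_lev s \<and>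
       set_decode (node_code s) \<inter> {..<node_lev t} = set_decode (node_code t) \<and>
       set_decode (node_code s) \<subseteq> Fs t \<longrightarrow> Fs s \<subseteq> Fs t)"
proof -
  have F: "in_F (history t) t x \<longleftrightarrow> x \<in> Fs t" for x by (simp add: Fs_def)
  have "node_code s mod 2 ^ node_lev t = node_code t \<longleftrightarrow>
      set_decode (node_code s) \<inter> {..<node_lev t} = set_decode (node_code t)" for s
    by (metis set_decode_mod set_decode_inverse)
  \<comment> \<open>The decidable check runs over \<open>x < s\<close>, which exhausts
    \<open>Fs s\<close> because its elements lie below \<open>s\<close>.\<close>
  moreover have "(\<forall>x<s. records (history t) s x \<longrightarrow> x \<in> Fs t) \<longleftrightarrow> Fs s \<subseteq> Fs t" if "s < t" "act s" for s
    using that by (auto simp: records_history Fs_def[of s] in_F_def)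
  ultimately show ?thesis
    unfolding act_def[of t] enters_def acted_history F by (auto simp: Ball_def subset_iff)
qed

lemma Fs_iff_in_F: "x \<in> Fs t \<longleftrightarrow> x < t \<and> x \<in> K (node_lev t) (set_decode (node_code t)) t \<and>
    (x < node_lev t \<longrightarrow> x \<in> set_decode (node_code t)) \<and>
    x \<in> bar t (node_lev t) (set_decode (node_code t)) \<and>
    (\<forall>m<node_lev t. set_decode (node_code t) \<subseteq> bar t m (set_decode (node_code t) \<inter> {..<m}) \<longrightarrow>
       x \<in> bar t m (set_decode (node_code t) \<inter> {..<m})) \<and>
    (\<forall>r<t. act r \<and> node_lev r < node_lev t \<and>
       set_decode (node_code r) = set_decode (node_code t) \<inter> {..<node_lev r} \<and>
       set_decode (node_code t) \<subseteq> Fs r \<longrightarrow> x \<in> V t (node_lev r) (set_decode (node_code r)))"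
proof -
  have cut: "node_code r = node_code t mod 2 ^ m \<longleftrightarrow>
      set_decode (node_code r) = set_decode (node_code t) \<inter> {..<m}" for r m
    by (metis set_decode_mod set_decode_inverse)
  have records: "acted (history t) r \<and> P \<and> Q \<and> (\<forall>y\<in>A. records (history t) r y) \<longleftrightarrow>
      r < t \<and> act r \<and> P \<and> Q \<and> A \<subseteq> Fs r" for A r P Q
    by (auto simp: acted_history records_history)
  have bar: "(\<forall>y\<in>A. in_bar (history t) t m a y) \<longleftrightarrow> A \<subseteq> bar t m (set_decode a)" for A m a
    by (auto simp: in_bar_history)
  have "x \<in> Fs t \<longleftrightarrow> in_F (history t) t x" by (simp add: Fs_def)
  then show ?thesis
    unfolding in_F_def bar in_bar_history in_V_history records cut set_decode_mod K_def mem_Collect_eq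
      set_decode_inverse by (simp cong: imp_cong)
qed

end

sublocale stage_codes \<subseteq> stages node_lev "\<lambda>s. set_decode (node_code s)" K act Fs
proof
  show "\<exists>s>k. node_lev s = m \<and> set_decode (node_code s) = A" if "finite A" for A k m
  proof (intro exI conjI)
    let ?s = "prod_encode (prod_encode (m, set_encode A), Suc k)"
    show "k < ?s" using le_prod_encode_2[of "Suc k" "prod_encode (m, set_encode A)"] by simp
    show "node_lev ?s = m" "set_decode (node_code ?s) = A"
      using that by (simp_all add: node_lev_def node_code_def)
  qed
  show "K m A t \<subseteq> K m A t'" if "t \<le> t'" for t t' m A
    using approx_mono[OF _ that] unfolding K_def by blast
  show "finite (set_decode (node_code s))" for s by simp
qed (rule act_iff_enters Fs_iff_in_F)+

context stage_codes
begin

text \<open>The stage \<open>s\<close> is a checkable witness, which makes the hulls c.e. uniformly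
  in the code of the finite set.\<close>

definition in_hull :: "nat \<Rightarrow> nat \<Rightarrow> bool" where
  "in_hull s n \<longleftrightarrow> snd (prod_decode n) \<in> set_decode (fst (prod_decode n)) \<or>
     enters (history s) s \<and> node_code s = fst (prod_decode n) mod 2 ^ node_lev s \<and>
     (\<forall>y\<in>set_decode (fst (prod_decode n)). in_F (history s) s y) \<and> in_F (history s) s (snd (prod_decode n))"

lemma decidable_in_hull: "decidable 2 (\<lambda>xs. in_hull (xs ! 0) (xs ! 1))"
  unfolding in_hull_def by (intro computable_intros) auto

lemma in_hull_iff: "(\<exists>s. in_hull s (prod_encode (d, x))) \<longleftrightarrow> x \<in> hull (set_decode d)"
proof -
  have "node_code s = d mod 2 ^ node_lev s \<longleftrightarrow> set_decode (node_code s) = set_decode d \<inter> {..<node_lev s}" for s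
    by (metis set_decode_mod set_decode_inverse)
  then have "in_hull s (prod_encode (d, x)) \<longleftrightarrow> x \<in> set_decode d \<or>
      act s \<and> set_decode (node_code s) = set_decode d \<inter> {..<node_lev s} \<and> set_decode d \<subseteq> Fs s \<and> x \<in> Fs s" for s
    unfolding in_hull_def act_def Fs_def by (simp add: subset_eq)
  then show ?thesis unfolding hull_def by blast
qed

end

lemma partial_computable_ex:
  assumes "decidable 2 (\<lambda>xs. P (xs ! 0) (xs ! 1))"
  shows "partial_computable (\<lambda>n. if \<exists>s. P s n then Some 0 else None)"
proof -
  \<comment> \<open>\<open>Mn\<close> looks for a zero, so the negation is tested; composition with
    \<open>Zero\<close> then forgets the witness found.\<close>
  have "decidable 2 (\<lambda>xs. \<not> P (xs ! 0) (xs ! 1))" using assms by (rule decidable_not)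
  then obtain r where r: "\<And>xs y. length xs = 2 \<Longrightarrow> eval_recf r xs y \<longleftrightarrow> y = of_bool (\<not> P (xs ! 0) (xs ! 1))"
    unfolding decidable_def computable_def by blast
  have "(\<exists>s. eval_recf (Mn r) [n] s) \<longleftrightarrow> (\<exists>s. P s n)" for n
    using exists_least_iff[of "\<lambda>s. P s n"] by (auto simp: eval_Mn r numeral_2_eq_2)
  then have "eval_recf (Comp Zero [Mn r]) [n] y \<longleftrightarrow> (\<exists>s. P s n) \<and> y = 0" for n y
    by (auto simp: eval_Comp list_all2_Cons1)
  then show ?thesis unfolding partial_computable_def by (intro exI[of _ "Comp Zero [Mn r]"]) auto
qed

section \<open>Learners\<close>

lemma content_seg_subset: "content_seg T n \<subseteq> content T"
  unfolding content_seg_def content_def by auto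

lemma content_seg_mono: "n \<le> m \<Longrightarrow> content_seg T n \<subseteq> content_seg T m"
  unfolding content_seg_def by (auto intro: less_le_trans)

lemma finite_content_seg: "finite (content_seg T n)"
proof -
  have "content_seg T n \<subseteq> (\<lambda>i. the (T i)) ` {..<n}" unfolding content_seg_def by force
  then show ?thesis by (rule finite_subset) simp
qed

lemma content_seg_exhausts:
  assumes "finite A" "A \<subseteq> content T" obtains n where "\<And>m. n \<le> m \<Longrightarrow> A \<subseteq> content_seg T m"
proof -
  have "\<exists>n. A \<subseteq> content_seg T n" using assms
  proof (induction A rule: finite_induct)
    case (insert x A)
    then obtain n i where "A \<subseteq> content_seg T n" "T i = Some x" unfolding content_def by auto
    then have "insert x A \<subseteq> content_seg T (max n (Suc i))"
      using content_seg_mono[of n "max n (Suc i)" T] unfolding content_seg_def by (auto simp: less_max_iff_disj)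
    then show ?case ..
  qed simp
  then show ?thesis using content_seg_mono that by (meson subset_trans)
qed

lemma SemWb_imp_SemConv:
  assumes "SemWb \<phi> p T" shows "SemConv \<phi> p T"
  unfolding SemConv_def
proof (intro allI impI)
  fix n m assume nm: "n < m \<and> content_seg T m \<subseteq> W \<phi> (p n)"
  show "W \<phi> (p n) = W \<phi> (p m)"
  proof (rule ccontr)
    assume "W \<phi> (p n) \<noteq> W \<phi> (p m)"
    then have "content_seg T m \<inter> W \<phi> (p m) - W \<phi> (p n) \<noteq> {}"
      using assms nm unfolding SemWb_def by (metis less_imp_le order_refl)
    then show False using nm by blast
  qed
qed

text \<open>A change at \<open>k\<close> is forced by a datum outside the earlier conjecture; it is
  still present at \<open>m\<close>, where consistency puts it into the current conjecture.\<close>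

lemma SemWb_if_conservative:
  assumes W: "\<And>n. W \<phi> (p n) = C (content_seg T n)"
    and cons: "\<And>D. D \<subseteq> C D"
    and conserv: "\<And>D D'. finite D' \<Longrightarrow> D \<subseteq> D' \<Longrightarrow> D' \<subseteq> C D \<Longrightarrow> C D' = C D"
  shows "SemWb \<phi> p T"
  unfolding SemWb_def
proof (intro allI impI)
  fix n m assume "\<exists>k\<ge>n. k \<le> m \<and> W \<phi> (p n) \<noteq> W \<phi> (p k)"
  then obtain k where k: "n \<le> k" "k \<le> m" "C (content_seg T n) \<noteq> C (content_seg T k)" unfolding W by blast
  then have "\<not> content_seg T k \<subseteq> C (content_seg T n)"
    using conserv[OF finite_content_seg content_seg_mono[OF k(1)]] by metis
  then show "content_seg T m \<inter> W \<phi> (p m) - W \<phi> (p n) \<noteq> {}"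
    using content_seg_mono[OF k(2)] cons[of "content_seg T m"] unfolding W by blast
qed

text \<open>The recursion strips \<open>i\<close> entries, \<open>y - 1\<close> undoing the
  \<open>Suc\<close> of a cons code. The empty list decodes to entry 0, a pause, so running past the
  end adds nothing. A list code bounds the length and the entries, so \<open>n\<close> bounds both
  searches.\<close>

definition content_of_code :: "nat \<Rightarrow> nat" where
  "content_of_code n = set_encode {x. x < n \<and> (\<exists>i<n. fst (prod_decode (rec_nat n (\<lambda>_ y. snd (prod_decode (y - 1))) i - 1)) = Suc x)}"

lemma computable_content_of_code: "computable 1 (\<lambda>xs. content_of_code (xs ! 0))"
  unfolding content_of_code_def by (intro computable_rec computable_pred computable_intros) auto

lemma content_of_code_seg: "content_of_code (code_seq (seg T n)) = code_set (content_seg T n)"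
proof -
  define xs where "xs = map (case_option 0 Suc) (seg T n)"
  let ?rest = "\<lambda>i. rec_nat (list_encode xs) (\<lambda>_ y. snd (prod_decode (y - 1))) i"
  have len: "length ys \<le> list_encode ys" for ys
    by (induction ys) (auto intro: order_trans le_prod_encode_2)
  have elem: "y < list_encode ys" if "y \<in> set ys" for y ys
    using that by (induction ys)
      (auto simp: less_Suc_eq_le le_prod_encode_1 intro: order_trans[OF less_imp_le le_prod_encode_2])
  have decode_0: "prod_decode 0 = (0, 0)"
    using prod_encode_inverse[of "(0, 0)"] by (simp add: prod_encode_def)
  have "snd (prod_decode (list_encode ys - 1)) = list_encode (tl ys)" for ys
    by (cases ys) (auto simp: decode_0)
  then have rest: "?rest i = list_encode (drop i xs)" for i
    by (induction i) (auto simp: drop_Suc tl_drop)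
  have head: "fst (prod_decode (list_encode ys - 1)) = Suc x \<longleftrightarrow> ys \<noteq> [] \<and> hd ys = Suc x" for ys x
    by (cases ys) (auto simp: decode_0)
  have "(\<exists>i<list_encode xs. fst (prod_decode (?rest i - 1)) = Suc x) \<longleftrightarrow> (\<exists>i<length xs. xs ! i = Suc x)" for x
    unfolding rest head using len[of xs] by (auto simp: hd_drop_conv_nth not_le intro: less_le_trans)
  also have "(\<exists>i<length xs. xs ! i = Suc x) \<longleftrightarrow> x \<in> content_seg T n" for x
    unfolding xs_def seg_def content_seg_def by (auto split: option.splits)
  finally have iff: "(\<exists>i<list_encode xs. fst (prod_decode (?rest i - 1)) = Suc x) \<longleftrightarrow> x \<in> content_seg T n" for x .
  have "x < list_encode xs" if "x \<in> content_seg T n" for x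
  proof -
    have "Suc x \<in> set xs" using that unfolding xs_def seg_def content_seg_def by force
    then show ?thesis using elem by fastforce
  qed
  then have "{x. x < list_encode xs \<and> (\<exists>i<list_encode xs. fst (prod_decode (?rest i - 1)) = Suc x)} = content_seg T n"
    unfolding iff by blast
  then show ?thesis by (simp add: content_of_code_def code_seq_def code_set_def flip: xs_def)
qed

lemma partial_computable_comp:
  assumes "partial_computable h" "computable 1 (\<lambda>xs. f (xs ! 0))"
  shows "partial_computable (\<lambda>n. h (f n))"
proof -
  obtain rh where rh: "\<And>x y. h x = Some y \<longleftrightarrow> eval_recf rh [x] y" using assms(1) unfolding partial_computable_def by blast
  obtain rf where rf: "\<And>x y. eval_recf rf [x] y \<longleftrightarrow> y = f x"
    using assms(2) unfolding computable_def by (metis One_nat_def length_Cons list.size(3) nth_Cons_0)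
  show ?thesis unfolding partial_computable_def
    by (rule exI[of _ "Comp rh [rf]"]) (auto simp: eval_Comp list_all2_Cons1 rf rh)
qed

lemma Sd_imp_G:
  assumes h: "partial_computable h"
  obtains h' where "partial_computable h'" "\<And>L. learns_tauSemWb_Sd_Bc \<phi> h L \<Longrightarrow> learns_G_SemConv_Bc \<phi> h' L"
proof
  show "partial_computable (\<lambda>n. h (content_of_code n))"
    by (rule partial_computable_comp[OF h computable_content_of_code])
  have "G (\<lambda>n. h (content_of_code n)) T = Sd h T" for T
    by (rule ext) (simp add: G_def Sd_def content_of_code_seg)
  then show "learns_G_SemConv_Bc \<phi> (\<lambda>n. h (content_of_code n)) L" if "learns_tauSemWb_Sd_Bc \<phi> h L" for L
    using that SemWb_imp_SemConv unfolding learns_tauSemWb_Sd_Bc_def learns_G_SemConv_Bc_def by simp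
qed

text \<open>For \<open>D \<subseteq> L\<close> the spliced text is a text for \<open>L\<close>, so
  the hypotheses on \<open>h\<close> apply to all nodes inside \<open>L\<close>, not only to those
  of \<open>L\<close> itself.\<close>

lemma seg_canon_splice:
  assumes "n \<le> M" shows "seg (\<lambda>i. if i < M then canon D i else canon L (i - M)) n = seg (canon (D \<inter> {..<n})) n"
  using assms unfolding seg_def canon_def by auto

context stage_codes
begin

lemma U_eq_W:
  assumes rh: "\<And>x y. h x = Some y \<longleftrightarrow> eval_recf rh [x] y"
    and ru: "\<And>x y. uncurried \<phi> x = Some y \<longleftrightarrow> eval_recf ru [x] y"
    and c: "h (canon_code m (set_encode A)) = Some e"
  shows "U m A = W \<phi> e"
proof
  let ?c = "canon_code m (set_encode A)"
  have e: "eval_recf rh [?c] e" using c rh by blast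
  \<comment> \<open>\<open>h\<close> is single-valued, so any visible result of \<open>rh\<close> on
    this code is \<open>e\<close>.\<close>
  have fuel_e: "fuel rh t [?c] = Suc e" if pos: "0 < fuel rh t [?c]" for t
  proof -
    obtain e' where e': "fuel rh t [?c] = Suc e'" using pos gr0_conv_Suc by blast
    then have "h ?c = Some e'" using rh fuel_imp_eval by blast
    then show ?thesis using c e' by simp
  qed
  have W: "x \<in> W \<phi> e \<longleftrightarrow> (\<exists>y. eval_recf ru [prod_encode (e, x)] y)" for x
    using ru[of "prod_encode (e, x)"] unfolding W_def uncurried_def by auto
  show "U m A \<subseteq> W \<phi> e"
  proof
    fix x assume "x \<in> U m A"
    then obtain t where "approx m (set_encode A) t x" unfolding U_def K_def by blast
    then have "0 < fuel ru t [prod_encode (e, x)]" using fuel_e[of t] unfolding approx_def by simp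
    then show "x \<in> W \<phi> e" unfolding W eval_iff_fuel using gr0_conv_Suc by blast
  qed
  show "W \<phi> e \<subseteq> U m A"
  proof
    fix x assume "x \<in> W \<phi> e"
    then obtain y t1 where t1: "fuel ru t1 [prod_encode (e, x)] = Suc y" unfolding W eval_iff_fuel by blast
    obtain t2 where t2: "fuel rh t2 [?c] = Suc e" using e eval_iff_fuel by blast
    have "approx m (set_encode A) (max t1 t2) x"
      using fuel_mono[OF t1, of "max t1 t2"] fuel_mono[OF t2, of "max t1 t2"] unfolding approx_def by simp
    then show "x \<in> U m A" unfolding U_def K_def by blast
  qed
qed

lemma hull_learns:
  assumes rh: "\<And>x y. h x = Some y \<longleftrightarrow> eval_recf rh [x] y"
    and ru: "\<And>x y. uncurried \<phi> x = Some y \<longleftrightarrow> eval_recf ru [x] y"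
    and L: "learns_G_SemConv_Bc \<phi> h L"
  obtains m where "\<And>D. finite D \<Longrightarrow> D \<subseteq> L \<Longrightarrow> L \<inter> {..<m} \<subseteq> D \<Longrightarrow> hull D = L"
proof -
  define T where "T D M = (\<lambda>i. if i < M then canon D i else canon L (i - M))" for D M
  have content_T: "content (T D M) = L" if "D \<subseteq> L" for D M
  proof
    show "content (T D M) \<subseteq> L"
      using that unfolding content_def T_def canon_def by (auto split: if_splits)
    show "L \<subseteq> content (T D M)"
    proof
      fix x assume "x \<in> L"
      then have "T D M (x + M) = Some x" unfolding T_def canon_def by simp
      then show "x \<in> content (T D M)" unfolding content_def by blast
    qed
  qed
  have U_G: "U n (D \<inter> {..<n}) = W \<phi> (the (G h (T D M) n))" if D: "D \<subseteq> L" and n: "n \<le> M" for D n M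
  proof (rule U_eq_W[OF rh ru])
    have "canon_code n (set_encode (D \<inter> {..<n})) = code_seq (seg (T D M) n)"
      unfolding canon_code_def T_def seg_canon_splice[OF n] by simp
    moreover have "G h (T D M) n \<noteq> None"
      using L content_T[OF D] unfolding learns_G_SemConv_Bc_def total_seq_def by blast
    ultimately show "h (canon_code n (set_encode (D \<inter> {..<n}))) = Some (the (G h (T D M) n))"
      unfolding G_def by simp
  qed
  \<comment> \<open>This is \<open>SemConv\<close> on the spliced text \<open>T D m\<close>, whose
    first \<open>m\<close> entries have content \<open>D \<inter> {..<m}\<close>.\<close>
  have conv: "U m (D \<inter> {..<m}) = U n (D \<inter> {..<n})"
    if D: "D \<subseteq> L" and nm: "n \<le> m" and sub: "D \<inter> {..<m} \<subseteq> U n (D \<inter> {..<n})" for D n m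
  proof (cases "n = m")
    case False
    have "content_seg (T D m) m = D \<inter> {..<m}" unfolding content_seg_def T_def canon_def by auto
    then show ?thesis
      using L content_T[OF D, of m] False nm sub U_G[OF D nm] U_G[OF D order_refl, of m]
      unfolding learns_G_SemConv_Bc_def SemConv_def by (metis order_le_imp_less_or_eq)
  qed simp
  have "\<exists>n. U n (L \<inter> {..<n}) = L"
  proof -
    have content: "content (canon L) = L" unfolding content_def canon_def by auto
    then obtain n where n: "W \<phi> (the (G h (canon L) n)) = L"
      using L unfolding learns_G_SemConv_Bc_def Bc_def by (metis order_refl)
    \<comment> \<open>\<open>Bc\<close> supplied \<open>n\<close> on the canonical text of
      \<open>L\<close>; splicing at \<open>n\<close> keeps these first \<open>n\<close>
      entries.\<close>
    have "seg (T L n) n = seg (canon L) n" unfolding T_def seg_def by auto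
    then have "G h (T L n) n = G h (canon L) n" unfolding G_def by simp
    then have "U n (L \<inter> {..<n}) = L" using U_G[of L n n] n by simp
    then show ?thesis ..
  qed
  then have n0: "U (LEAST n. U n (L \<inter> {..<n}) = L) (L \<inter> {..<LEAST n. U n (L \<inter> {..<n}) = L}) = L"
    by (rule LeastI_ex)
  from hull_eq[OF conv n0 Least_le] that show ?thesis by blast
qed

end

text \<open>Acceptability turns the uniform enumeration of hulls into a total computable index
  function on codes of finite sets; that function is the set-driven learner.\<close>

lemma G_imp_Sd:
  assumes acc: "acceptable \<phi>" and h: "partial_computable h"
  obtains h' where "partial_computable h'" "\<And>L. learns_G_SemConv_Bc \<phi> h L \<Longrightarrow> learns_tauSemWb_Sd_Bc \<phi> h' L"
proof -
  obtain rh where rh: "\<And>x y. h x = Some y \<longleftrightarrow> eval_recf rh [x] y"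
    using h unfolding partial_computable_def by blast
  obtain ru where ru: "\<And>x y. uncurried \<phi> x = Some y \<longleftrightarrow> eval_recf ru [x] y"
    using acc unfolding acceptable_def partial_computable_def by blast
  interpret stage_codes rh ru .
  let ?psi = "\<lambda>d x. if x \<in> hull (set_decode d) then Some 0 else None"
  have "uncurried ?psi = (\<lambda>n. if \<exists>s. in_hull s n then Some 0 else None)"
    unfolding uncurried_def in_hull_iff[symmetric] by simp
  then have "partial_computable (uncurried ?psi)"
    using partial_computable_ex[OF decidable_in_hull] by simp
  then obtain t where t: "total_computable t" "\<And>e. \<phi> (t e) = ?psi e"
    using acc unfolding acceptable_def by blast
  have W: "W \<phi> (t (code_set D)) = hull D" if "finite D" for D
    using that unfolding W_def t(2) code_set_def by simp
  show ?thesis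
  proof
    show "partial_computable (\<lambda>x. Some (t x))" using t(1) unfolding total_computable_def .
    fix L assume L: "learns_G_SemConv_Bc \<phi> h L"
    obtain m where m: "\<And>D. finite D \<Longrightarrow> D \<subseteq> L \<Longrightarrow> L \<inter> {..<m} \<subseteq> D \<Longrightarrow> hull D = L"
      using hull_learns[OF rh ru L] by blast
    have "Bc \<phi> (\<lambda>i. the (Sd (\<lambda>x. Some (t x)) T i)) T" if T: "content T = L" for T
    proof -
      obtain n where n: "\<And>k. n \<le> k \<Longrightarrow> L \<inter> {..<m} \<subseteq> content_seg T k"
        using content_seg_exhausts[of "L \<inter> {..<m}" T] T by auto
      have "W \<phi> (t (code_set (content_seg T k))) = content T" if "n \<le> k" for k
        using m[OF finite_content_seg _ n[OF that]] content_seg_subset[of T k] T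
        by (simp add: W finite_content_seg)
      then show ?thesis unfolding Bc_def Sd_def by auto
    qed
    moreover have "SemWb \<phi> (\<lambda>i. the (Sd (\<lambda>x. Some (t x)) T i)) T" for T
      by (rule SemWb_if_conservative[where C = hull])
        (simp_all add: Sd_def W finite_content_seg subset_hull hull_conservative)
    ultimately show "learns_tauSemWb_Sd_Bc \<phi> (\<lambda>x. Some (t x)) L"
      unfolding learns_tauSemWb_Sd_Bc_def by (simp add: total_seq_def Sd_def)
  qed
qed

theorem theorem11:
  assumes "acceptable \<phi>"
  shows "learnable_classes (learns_tauSemWb_Sd_Bc \<phi>) = learnable_classes (learns_G_SemConv_Bc \<phi>)"
proof
  show "learnable_classes (learns_tauSemWb_Sd_Bc \<phi>) \<subseteq> learnable_classes (learns_G_SemConv_Bc \<phi>)"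
    unfolding learnable_classes_def by clarify (metis Sd_imp_G)
  show "learnable_classes (learns_G_SemConv_Bc \<phi>) \<subseteq> learnable_classes (learns_tauSemWb_Sd_Bc \<phi>)"
    unfolding learnable_classes_def by clarify (metis G_imp_Sd[OF assms])
qed

end
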